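(* Let $\phi$ be a linear fractional self-map of the unit disk $\mathbb D$, and let $C_\phi:H^2(\mathbb D)\to H^2(\mathbb D)$, $C_\phi f=f\circ\phi$. Then $C_\phi$ is recurrent if and only if $\phi$ is either hyperbolic with no fixed point in $\mathbb D$, or a parabolic automorphism of $\mathbb D$, or an elliptic automorphism of $\mathbb D$.
   Context: $H^2(\mathbb D)$ is the Hardy space of holomorphic $f$ on $\mathbb D$ with $\|f\|^2=\sup_{0\le r<1}\frac1{2\pi}\int_0^{2\pi}|f(re^{i\theta})|^2d\theta<\infty$. A linear fractional self-map of $\mathbb D$ is a map $\phi(z)=(az+b)/(cz+d)$ with $ad-bc\neq0$ and $\phi(\mathbb D)\subset\mathbb D$; it is an automorphism if $\phi(\mathbb D)=\mathbb D$. Such a map has one or two fixed points in the extended plane $\hat{\mathbb C}$. It is parabolic if it has no fixed point in $\mathbb D$ and a unique (attractive) fixed point, lying on $\mathbb T=\partial\mathbb D$; it is hyperbolic (with attractive fixed point on $\mathbb T$) if it has an attractive fixed point $\alpha\in\mathbb T$ and a second fixed point $\beta\in\hat{\mathbb C}\setminus\mathbb D$; it is an elliptic automorphism if it is an automorphism of $\mathbb D$ having a fixed point in $\mathbb D$ (the second fixed point lying in $\hat{\mathbb C}\setminus\overline{\mathbb D}$). An operator $T$ on a Banach space $X$ is recurrent if for every non-empty open $U\subset X$ there is a positive integer $k$ with $U\cap T^{-k}(U)\neq\emptyset$. *)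

theory Defs
  imports "HOL-Analysis.Analysis"
begin

definition D :: "complex set" where "D = ball 0 1"

definition h2_mean :: "(complex \<Rightarrow> complex) \<Rightarrow> real \<Rightarrow> real" where
  "h2_mean f r = (1 / (2 * pi)) *
     integral {0..2*pi} (\<lambda>\<theta>. (cmod (f (complex_of_real r * cis \<theta>)))\<^sup>2)"

definition hardy2 :: "(complex \<Rightarrow> complex) set" where
  "hardy2 = {f. f holomorphic_on D \<and> bdd_above (h2_mean f ` {0..<1})}"

definition h2_norm :: "(complex \<Rightarrow> complex) \<Rightarrow> real" where
  "h2_norm f = sqrt (SUP r\<in>{0..<1}. h2_mean f r)"

text \<open>Open subsets of H^2 for the norm topology (functions are only relevant on D;
  open sets are automatically saturated w.r.t. equality on D).\<close>
definition h2_open :: "(complex \<Rightarrow> complex) set \<Rightarrow> bool" where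
  "h2_open U \<longleftrightarrow> U \<subseteq> hardy2 \<and>
     (\<forall>f\<in>U. \<exists>e>0. \<forall>g\<in>hardy2. h2_norm (\<lambda>z. g z - f z) < e \<longrightarrow> g \<in> U)"

definition h2_recurrent :: "((complex \<Rightarrow> complex) \<Rightarrow> (complex \<Rightarrow> complex)) \<Rightarrow> bool" where
  "h2_recurrent T \<longleftrightarrow>
     (\<forall>U. h2_open U \<and> U \<noteq> {} \<longrightarrow> (\<exists>k>0. \<exists>f\<in>U. (T ^^ k) f \<in> U))"

definition comp_op :: "(complex \<Rightarrow> complex) \<Rightarrow> (complex \<Rightarrow> complex) \<Rightarrow> (complex \<Rightarrow> complex)" where
  "comp_op \<phi> f = f \<circ> \<phi>"

definition lft :: "complex \<Rightarrow> complex \<Rightarrow> complex \<Rightarrow> complex \<Rightarrow> complex \<Rightarrow> complex" where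
  "lft a b c d z = (a * z + b) / (c * z + d)"

definition lf_selfmap :: "complex \<Rightarrow> complex \<Rightarrow> complex \<Rightarrow> complex \<Rightarrow> bool" where
  "lf_selfmap a b c d \<longleftrightarrow> a * d - b * c \<noteq> 0 \<and>
     (\<forall>z\<in>D. c * z + d \<noteq> 0 \<and> lft a b c d z \<in> D)"

definition lf_automorphism :: "complex \<Rightarrow> complex \<Rightarrow> complex \<Rightarrow> complex \<Rightarrow> bool" where
  "lf_automorphism a b c d \<longleftrightarrow> lf_selfmap a b c d \<and> lft a b c d ` D = D"

text \<open>Fixed points in the extended plane: None stands for \<infinity>.\<close>
definition lf_fixed :: "complex \<Rightarrow> complex \<Rightarrow> complex \<Rightarrow> complex \<Rightarrow> complex option \<Rightarrow> bool" where
  "lf_fixed a b c d p = (case p of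
      None \<Rightarrow> c = 0
    | Some z \<Rightarrow> c * z + d \<noteq> 0 \<and> lft a b c d z = z)"

definition lf_attractive :: "complex \<Rightarrow> complex \<Rightarrow> complex \<Rightarrow> complex \<Rightarrow> complex \<Rightarrow> bool" where
  "lf_attractive a b c d \<alpha> \<longleftrightarrow> lf_fixed a b c d (Some \<alpha>) \<and>
     (\<forall>z\<in>D. (\<lambda>n. (lft a b c d ^^ n) z) \<longlonglongrightarrow> \<alpha>)"

definition lf_parabolic :: "complex \<Rightarrow> complex \<Rightarrow> complex \<Rightarrow> complex \<Rightarrow> bool" where
  "lf_parabolic a b c d \<longleftrightarrow>
     (\<forall>z\<in>D. \<not> lf_fixed a b c d (Some z)) \<and>
     (\<exists>\<alpha>. cmod \<alpha> = 1 \<and> lf_attractive a b c d \<alpha> \<and>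
           (\<forall>p. lf_fixed a b c d p \<longleftrightarrow> p = Some \<alpha>))"

definition lf_hyperbolic :: "complex \<Rightarrow> complex \<Rightarrow> complex \<Rightarrow> complex \<Rightarrow> bool" where
  "lf_hyperbolic a b c d \<longleftrightarrow>
     (\<exists>\<alpha> \<beta>. cmod \<alpha> = 1 \<and> lf_attractive a b c d \<alpha> \<and>
            lf_fixed a b c d \<beta> \<and> \<beta> \<noteq> Some \<alpha> \<and> (\<forall>z\<in>D. \<beta> \<noteq> Some z))"

definition lf_elliptic_aut :: "complex \<Rightarrow> complex \<Rightarrow> complex \<Rightarrow> complex \<Rightarrow> bool" where
  "lf_elliptic_aut a b c d \<longleftrightarrow> lf_automorphism a b c d \<and> (\<exists>z\<in>D. lf_fixed a b c d (Some z))"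

end

(*
In the coordinate w = (alpha + z) / (alpha - z) at a boundary fixed point alpha, a self-map without
fixed point in the disc becomes w -> kappa w + mu on the right half-plane, with kappa >= 1 and
Re mu >= 0 after possibly exchanging the two fixed points. If kappa > 1, or if kappa = 1 and mu is
imaginary, functions G decaying at the fixed points are dense, and the orbit of g + s, where
s = g o phi^(-n) extends to the disc, returns to the vicinity of g: both g o phi^n and s tend to 0. All
norms are estimated by the mean value property: if Re X > 0, then Q = X / (1 + X) satisfies
|Q|^2 <= Re Q, so that ||Q||^2 <= Re Q(0). If kappa = 1 and Re mu > 0, then f(phi^(k+1) 0) - f(phi^k 0)
tends to 0 uniformly on bounded sets of f, so that f o phi^k stays away from the identity function.
A map with a fixed point p in the disc is, by the Schwarz lemma, conjugate to a rotation, or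
|phi'(p)| < 1; in the latter case f |-> f'(p) is an eigenvector of the adjoint and forbids recurrence.
*)

theory Submission
  imports Defs "HOL-Complex_Analysis.Complex_Analysis" "HOL-Real_Asymp.Real_Asymp"
begin

section \<open>The Hardy space\<close>

text \<open>A hyperbolic \<phi> need not be onto, so g o \<phi>^(-n) makes sense only if g lives on
  more than the disc. This is why the functions G are defined on a whole half-plane, in the
  coordinate v = w + \<gamma> that moves the finite fixed point -\<gamma> of w -> \<kappa> w + \<mu>
  to 0: dividing v by \<kappa>^n preserves the half-plane, though perhaps not the image of the disc.

  The parabolic dichotomy rests on comparing rates. Translation by \<mu> moves the orbit x_k of 0 by
  steps of order k^(-2). If Re \<mu> > 0, the distance of x_k to the circle is of order 1/k, and
  derivatives of H^2 functions grow at most like the distance to the power -3/2; hence increments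
  along the orbit are of order k^(3/2 - 2) and vanish in the limit. If \<mu> is imaginary, the
  distance is itself of order k^(-2) and the estimate breaks down, as it must. The contradiction
  comes from two values: if f o \<phi>^k is close to the identity, then f(x_k) is close to 0 and
  f(x_(k+1)) is close to \<phi>(0).\<close>

lemma circle_in_D: "0 \<le> r \<Longrightarrow> r < 1 \<Longrightarrow> complex_of_real r * cis t \<in> D"
  by (simp add: D_def norm_mult)

text \<open>The substitution \<open>u = r * cis t\<close> turns du/(u - w) into \<open>\<i>\<close>
  dt times the kernel \<open>r * cis t / (r * cis t - w)\<close>. Cauchy's formula becomes an
  ordinary integral, comparable with the one in \<open>h2_mean\<close>.\<close>

lemma cauchy_circle:
  assumes "F holomorphic_on D" "0 < r" "r < 1" "cmod w < r"
  shows "((\<lambda>t. F (complex_of_real r * cis t) * (r * cis t / (r * cis t - w)))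
           has_integral 2 * of_real pi * F w) {0..2*pi}"
proof -
  have sub: "cball 0 r \<subseteq> D" using assms by (auto simp: D_def)
  have "((\<lambda>u. F u/(u-w)) has_contour_integral (2 * of_real pi * \<i> * F w)) (circlepath 0 r)"
  proof (rule Cauchy_integral_circlepath)
    show "continuous_on (cball 0 r) F"
      using assms(1) sub holomorphic_on_imp_continuous_on continuous_on_subset by blast
    show "F holomorphic_on ball 0 r"
      using assms(1) sub ball_subset_cball holomorphic_on_subset by blast
  qed (use assms in auto)
  then have "((\<lambda>t. F (0 + r * cis t) / (0 + r * cis t - w) * r * \<i> * cis t)
      has_integral 2 * of_real pi * \<i> * F w) {0..2*pi}"
    unfolding circlepath_def by (subst (asm) has_contour_integral_part_circlepath_iff) auto
  from has_integral_mult_right[OF this, of "-\<i>"] show ?thesis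
    by (simp add: algebra_simps)
qed

lemma mean_value_circle:
  assumes "F holomorphic_on D" "0 \<le> r" "r < 1"
  shows "((\<lambda>t. F (complex_of_real r * cis t)) has_integral 2 * of_real pi * F 0) {0..2*pi}"
proof (cases "r = 0")
  case True
  then show ?thesis
    using has_integral_const_real[of "F 0" 0 "2*pi"] by (simp add: scaleR_conv_of_real)
next
  case False
  then show ?thesis using cauchy_circle[of F r 0] assms
    by (simp add: divide_self_if)
qed

lemma integrable_circle:
  fixes f :: "complex \<Rightarrow> 'a::banach"
  assumes "continuous_on D f" "0 \<le> r" "r < 1"
  shows "(\<lambda>t. f (complex_of_real r * cis t)) integrable_on {0..2*pi}"
proof (rule integrable_continuous_real)
  show "continuous_on {0..2*pi} (\<lambda>t. f (complex_of_real r * cis t))"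
    by (rule continuous_on_compose2[OF assms(1)]) (auto intro!: continuous_intros circle_in_D assms)
qed

text \<open>The estimates for bounded functions, for sums and for functions dominated by Q all pass
  through this comparison, with a majorant \<open>u\<close> whose integral is known exactly.\<close>

lemma h2_mean_le_integral:
  assumes f: "continuous_on D f" and r: "0 \<le> r" "r < 1"
    and u: "((\<lambda>t. u (complex_of_real r * cis t)) has_integral 2 * pi * B) {0..2*pi}"
    and le: "\<And>z. z \<in> D \<Longrightarrow> (cmod (f z))\<^sup>2 \<le> u z"
  shows "h2_mean f r \<le> B"
proof -
  have "integral {0..2*pi} (\<lambda>t. (cmod (f (complex_of_real r * cis t)))\<^sup>2) \<le> 2 * pi * B"
  proof (rule has_integral_le[OF integrable_integral u])
    show "(\<lambda>t. (cmod (f (complex_of_real r * cis t)))\<^sup>2) integrable_on {0..2*pi}"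
      by (rule integrable_circle[where f="\<lambda>z. (cmod (f z))\<^sup>2"]) (intro continuous_intros f r)+
  qed (auto intro!: le circle_in_D r)
  then show ?thesis by (simp add: h2_mean_def field_simps)
qed

lemma h2_mean_nonneg: "0 \<le> h2_mean f r"
proof -
  \<comment> \<open>In the non-integrable case the integral has the default value 0.\<close>
  have "0 \<le> integral {0..2*pi} (\<lambda>t. (cmod (f (complex_of_real r * cis t)))\<^sup>2)"
    by (cases "(\<lambda>t. (cmod (f (complex_of_real r * cis t)))\<^sup>2) integrable_on {0..2*pi}")
       (simp_all add: integral_nonneg not_integrable_integral)
  then show ?thesis by (simp add: h2_mean_def)
qed

lemma h2_mean_le_bound:
  assumes "continuous_on D f" "0 \<le> r" "r < 1" "\<And>z. z \<in> D \<Longrightarrow> cmod (f z) \<le> c"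
  shows "h2_mean f r \<le> c\<^sup>2"
proof (rule h2_mean_le_integral[OF assms(1-3), where u="\<lambda>_. c\<^sup>2"])
  show "((\<lambda>t. c\<^sup>2) has_integral 2 * pi * c\<^sup>2) {0..2 * pi}"
    using has_integral_const_real[of "c\<^sup>2" 0 "2*pi"] by simp
qed (use assms(4) in \<open>simp add: power_mono\<close>)

lemma has_integral_h2_mean:
  assumes "continuous_on D f" "0 \<le> r" "r < 1"
  shows "((\<lambda>t. (cmod (f (complex_of_real r * cis t)))\<^sup>2) has_integral 2 * pi * h2_mean f r) {0..2*pi}"
proof -
  have "(\<lambda>t. (cmod (f (complex_of_real r * cis t)))\<^sup>2) integrable_on {0..2*pi}"
    by (rule integrable_circle[where f="\<lambda>z. (cmod (f z))\<^sup>2"]) (intro continuous_intros assms)+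
  then show ?thesis by (simp add: h2_mean_def has_integral_iff)
qed

lemma hardy2_continuous: "f \<in> hardy2 \<Longrightarrow> continuous_on D f"
  by (simp add: hardy2_def holomorphic_on_imp_continuous_on)

lemma hardy2_holomorphic: "f \<in> hardy2 \<Longrightarrow> f holomorphic_on D"
  by (simp add: hardy2_def)

lemma h2_mean_le_norm:
  assumes "f \<in> hardy2" "0 \<le> r" "r < 1"
  shows "h2_mean f r \<le> (h2_norm f)\<^sup>2"
proof -
  have le: "h2_mean f r \<le> (SUP r\<in>{0..<1}. h2_mean f r)"
    using assms by (intro cSUP_upper) (auto simp: hardy2_def)
  then have "0 \<le> (SUP r\<in>{0..<1}. h2_mean f r)"
    using h2_mean_nonneg order_trans by blast
  with le show ?thesis by (simp add: h2_norm_def)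
qed

lemma hardy2I:
  assumes "f holomorphic_on D" "\<And>r. 0 \<le> r \<Longrightarrow> r < 1 \<Longrightarrow> h2_mean f r \<le> B"
  shows "f \<in> hardy2"
  using assms by (auto simp: hardy2_def intro!: bdd_aboveI[where M=B])

lemma h2_norm_le:
  assumes "\<And>r. 0 \<le> r \<Longrightarrow> r < 1 \<Longrightarrow> h2_mean f r \<le> B\<^sup>2" "0 \<le> B"
  shows "h2_norm f \<le> B"
proof -
  have "(SUP r\<in>{0..<1}. h2_mean f r) \<le> B\<^sup>2"
    by (rule cSUP_least) (use assms in auto)
  then show ?thesis using assms(2) unfolding h2_norm_def
    by (simp add: real_le_lsqrt)
qed

lemma h2_norm_nonneg: "0 \<le> h2_norm f" if "f \<in> hardy2"
proof -
  have "h2_mean f 0 \<le> (SUP r\<in>{0..<1}. h2_mean f r)"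
    using that by (intro cSUP_upper) (auto simp: hardy2_def)
  then show ?thesis unfolding h2_norm_def using h2_mean_nonneg[of f 0] by simp
qed

lemma bounded_hardy2:
  assumes "f holomorphic_on D" "\<And>z. z \<in> D \<Longrightarrow> cmod (f z) \<le> c"
  shows "f \<in> hardy2" "h2_norm f \<le> c"
proof -
  have m: "h2_mean f r \<le> c\<^sup>2" if "0 \<le> r" "r < 1" for r
    using that assms by (intro h2_mean_le_bound holomorphic_on_imp_continuous_on) auto
  then show "f \<in> hardy2" using assms(1) hardy2I by blast
  have "0 \<le> cmod (f 0)" "0 \<in> D" by (auto simp: D_def)
  then have "0 \<le> c" using assms(2) order_trans by blast
  then show "h2_norm f \<le> c" using m h2_norm_le by blast
qed

text \<open>Expansion of (b x - a y)^2 >= 0. The weights make the bound an equality at x = a, y = b,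
  so that integrating it yields Minkowski's inequality.\<close>

lemma square_sum_le:
  fixes x y a b :: real
  assumes "0 < a" "0 < b"
  shows "(x + y)\<^sup>2 \<le> (1 + b / a) * x\<^sup>2 + (1 + a / b) * y\<^sup>2"
proof -
  have "0 \<le> (b * x - a * y)\<^sup>2 / (a * b)" using assms by simp
  also have "\<dots> = b / a * x\<^sup>2 + a / b * y\<^sup>2 - 2 * x * y"
    using assms by (simp add: field_simps power2_eq_square)
  finally show ?thesis by (simp add: algebra_simps power2_eq_square)
qed

text \<open>The numbers \<open>a\<close> and \<open>b\<close> stand strictly above the norms because
  a norm may be 0 and then cannot serve in the weights b/a and a/b. The triangle inequality follows
  by letting them decrease to the norms.\<close>

lemma h2_add_aux:
  assumes f: "f \<in> hardy2" and g: "g \<in> hardy2" and r: "0 \<le> r" "r < 1"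
    and a: "h2_norm f < a" and b: "h2_norm g < b"
  shows "h2_mean (\<lambda>z. f z + g z) r \<le> (a + b)\<^sup>2"
proof -
  have ab: "0 < a" "0 < b" using h2_norm_nonneg f g a b by fastforce+
  note cont = hardy2_continuous[OF f] hardy2_continuous[OF g]
  have "h2_mean (\<lambda>z. f z + g z) r \<le> (1 + b/a) * h2_mean f r + (1 + a/b) * h2_mean g r"
  proof (rule h2_mean_le_integral[where u="\<lambda>z. (1 + b/a) * (cmod (f z))\<^sup>2 + (1 + a/b) * (cmod (g z))\<^sup>2"])
    show "((\<lambda>t. (1 + b/a) * (cmod (f (complex_of_real r * cis t)))\<^sup>2 +
             (1 + a/b) * (cmod (g (complex_of_real r * cis t)))\<^sup>2) has_integral
          2 * pi * ((1 + b/a) * h2_mean f r + (1 + a/b) * h2_mean g r)) {0..2 * pi}"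
      using has_integral_add[OF has_integral_mult_right[OF has_integral_h2_mean[OF cont(1) r], of "1+b/a"]
             has_integral_mult_right[OF has_integral_h2_mean[OF cont(2) r], of "1+a/b"]]
      by (simp add: algebra_simps)
    fix z
    have "(cmod (f z + g z))\<^sup>2 \<le> (cmod (f z) + cmod (g z))\<^sup>2"
      by (simp add: norm_triangle_ineq power_mono)
    also note square_sum_le[OF ab]
    finally show "(cmod (f z + g z))\<^sup>2 \<le> (1 + b/a) * (cmod (f z))\<^sup>2 + (1 + a/b) * (cmod (g z))\<^sup>2" .
  qed (intro continuous_intros cont r)+
  also have "\<dots> \<le> (1 + b/a) * a\<^sup>2 + (1 + a/b) * b\<^sup>2"
  proof (intro add_mono mult_left_mono)
    show "h2_mean f r \<le> a\<^sup>2"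
      using h2_mean_le_norm[OF f r] power_mono[of "h2_norm f" a 2] h2_norm_nonneg[OF f] a by linarith
    show "h2_mean g r \<le> b\<^sup>2"
      using h2_mean_le_norm[OF g r] power_mono[of "h2_norm g" b 2] h2_norm_nonneg[OF g] b by linarith
  qed (use ab in auto)
  also have "\<dots> = (a + b)\<^sup>2" using ab by (simp add: field_simps power2_eq_square)
  finally show ?thesis .
qed

lemma hardy2_add:
  assumes f: "f \<in> hardy2" and g: "g \<in> hardy2"
  shows "(\<lambda>z. f z + g z) \<in> hardy2"
proof (rule hardy2I)
  show "(\<lambda>z. f z + g z) holomorphic_on D"
    using assms by (intro holomorphic_intros) (auto simp: hardy2_def)
  show "h2_mean (\<lambda>z. f z + g z) r \<le> ((h2_norm f + 1) + (h2_norm g + 1))\<^sup>2" if "0 \<le> r" "r < 1" for r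
    using that assms by (intro h2_add_aux) auto
qed

lemma h2_norm_triangle:
  assumes f: "f \<in> hardy2" and g: "g \<in> hardy2"
  shows "h2_norm (\<lambda>z. f z + g z) \<le> h2_norm f + h2_norm g"
proof (rule field_le_epsilon)
  fix e :: real assume "0 < e"
  then have "h2_norm (\<lambda>z. f z + g z) \<le> (h2_norm f + e/2) + (h2_norm g + e/2)"
    using h2_norm_nonneg f g by (intro h2_norm_le h2_add_aux) (auto intro!: add_nonneg_nonneg)
  then show "h2_norm (\<lambda>z. f z + g z) \<le> h2_norm f + h2_norm g + e" by simp
qed

lemma h2_norm_minus: "h2_norm (\<lambda>z. - f z) = h2_norm f"
  by (simp add: h2_norm_def h2_mean_def)

lemma hardy2_minus: "f \<in> hardy2 \<Longrightarrow> (\<lambda>z. - f z) \<in> hardy2"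
  by (auto simp: hardy2_def h2_mean_def[abs_def] intro: holomorphic_on_minus)

lemma hardy2_diff: "f \<in> hardy2 \<Longrightarrow> g \<in> hardy2 \<Longrightarrow> (\<lambda>z. f z - g z) \<in> hardy2"
  using hardy2_add[OF _ hardy2_minus, of f g] by simp

lemma h2_norm_diff_triangle:
  assumes "f \<in> hardy2" "g \<in> hardy2" "h \<in> hardy2"
  shows "h2_norm (\<lambda>z. f z - h z) \<le> h2_norm (\<lambda>z. f z - g z) + h2_norm (\<lambda>z. g z - h z)"
  using h2_norm_triangle[of "\<lambda>z. f z - g z" "\<lambda>z. g z - h z"] hardy2_diff assms by simp

lemma h2_norm_diff_commute: "h2_norm (\<lambda>z. f z - g z) = h2_norm (\<lambda>z. g z - f z)"
  using h2_norm_minus[of "\<lambda>z. f z - g z"] by simp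

text \<open>Cauchy's formula is applied to the square of the function, which gives the exponent 1/2.\<close>
lemma h2_growth:
  assumes f: "f \<in> hardy2" and w: "w \<in> D"
  shows "cmod (f w) \<le> h2_norm f / sqrt (1 - cmod w)"
proof -
  have w1: "cmod w < 1" using w by (simp add: D_def)
  note cont = hardy2_continuous[OF f]
  \<comment> \<open>The circle of radius \<open>r\<close> only has to surround \<open>w\<close>; at
    the end \<open>r\<close> tends to 1.\<close>
  have *: "(cmod (f w))\<^sup>2 * (r - cmod w) \<le> (h2_norm f)\<^sup>2" if r: "cmod w < r" "r < 1" for r
  proof -
    have r0: "0 < r" using r(1) norm_ge_zero[of w] by linarith
    let ?z = "\<lambda>t. complex_of_real r * cis t"
    have "((\<lambda>t. (f (?z t))\<^sup>2 * (r * cis t / (r * cis t - w)))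
           has_integral 2 * of_real pi * (f w)\<^sup>2) {0..2*pi}"
      using cauchy_circle[of "\<lambda>z. (f z)\<^sup>2" r w] r r0 f
      by (auto simp: hardy2_def intro!: holomorphic_intros)
    moreover have "((\<lambda>t. (cmod (f (?z t)))\<^sup>2 * (r / (r - cmod w))) has_integral
        2 * pi * h2_mean f r * (r / (r - cmod w))) {0..2*pi}"
      using r r0 by (intro has_integral_mult_left has_integral_h2_mean cont) auto
    moreover have "cmod ((f (?z t))\<^sup>2 * (r * cis t / (r * cis t - w)))
        \<le> (cmod (f (?z t)))\<^sup>2 * (r / (r - cmod w))" for t
    proof -
      have "r - cmod w \<le> cmod (r * cis t - w)"
        using norm_triangle_ineq2[of "r * cis t" w] r0 by (simp add: norm_mult)
      then show ?thesis using r r0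
        by (auto simp: norm_mult norm_divide norm_power intro!: mult_left_mono divide_left_mono mult_pos_pos)
    qed
    ultimately have "cmod (2 * of_real pi * (f w)\<^sup>2) \<le> 2 * pi * h2_mean f r * (r / (r - cmod w))"
      by (metis (no_types, lifting) integral_norm_bound_integral integral_unique has_integral_integrable)
    then have "2 * pi * (cmod (f w))\<^sup>2 \<le> 2 * pi * h2_mean f r * r / (r - cmod w)"
      by (simp add: norm_mult norm_power)
    then have "2 * pi * (cmod (f w))\<^sup>2 * (r - cmod w) \<le> 2 * pi * h2_mean f r * r"
      using r by (subst (asm) pos_le_divide_eq) auto
    then have "2 * pi * ((cmod (f w))\<^sup>2 * (r - cmod w)) \<le> 2 * pi * (h2_mean f r * r)"
      by (simp only: mult.assoc)
    then have "(cmod (f w))\<^sup>2 * (r - cmod w) \<le> h2_mean f r * r"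
      by (subst (asm) mult_le_cancel_left_pos) auto
    also have "\<dots> \<le> h2_mean f r * 1" using r r0 h2_mean_nonneg by (intro mult_left_mono) auto
    also have "\<dots> \<le> (h2_norm f)\<^sup>2" using h2_mean_le_norm[OF f, of r] r r0 by simp
    finally show ?thesis .
  qed
  have "((\<lambda>r. (cmod (f w))\<^sup>2 * (r - cmod w)) \<longlongrightarrow> (cmod (f w))\<^sup>2 * (1 - cmod w)) (at_left 1)"
    by (intro tendsto_intros)
  moreover have "\<forall>\<^sub>F r in at_left 1. (cmod (f w))\<^sup>2 * (r - cmod w) \<le> (h2_norm f)\<^sup>2"
    using eventually_at_left_real[OF w1] by eventually_elim (use * in auto)
  ultimately have "(cmod (f w))\<^sup>2 * (1 - cmod w) \<le> (h2_norm f)\<^sup>2"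
    using tendsto_upperbound trivial_limit_at_left_real by blast
  then have "(cmod (f w))\<^sup>2 \<le> (h2_norm f / sqrt (1 - cmod w))\<^sup>2"
    using w1 by (simp add: power_divide field_simps)
  moreover have "0 \<le> h2_norm f / sqrt (1 - cmod w)" using w1 h2_norm_nonneg[OF f] by simp
  ultimately show ?thesis using power2_le_imp_le by blast
qed

text \<open>Cauchy's inequality on a disc of radius d = (1 - r)/2, which stays at distance at least
  d from the circle. The growth bound contributes the exponent 1/2, the derivative another
  1.\<close>

lemma h2_deriv_bound:
  assumes f: "f \<in> hardy2" and r: "r < 1" and w: "cmod w \<le> r"
  shows "cmod (deriv f w) \<le> h2_norm f * (2 / (1 - r)) powr (3/2)"
proof -
  define d where "d = (1 - r) / 2"
  have d: "0 < d" using r by (simp add: d_def)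
  have sub: "cball w d \<subseteq> cball 0 (1 - d)"
  proof
    fix x assume "x \<in> cball w d"
    then have "cmod x \<le> cmod w + d" using norm_triangle_ineq[of w "x - w"]
      by (simp add: dist_norm norm_minus_commute)
    then show "x \<in> cball 0 (1 - d)" using w by (simp add: d_def field_simps)
  qed
  then have subD: "cball w d \<subseteq> D" using d by (auto simp: D_def)
  have hol: "f holomorphic_on D" using f by (simp add: hardy2_def)
  have "norm ((deriv ^^ 1) f w) \<le> fact 1 * (h2_norm f / sqrt d) / d ^ 1"
  proof (rule Cauchy_inequality)
    show "f holomorphic_on ball w d" using hol subD ball_subset_cball holomorphic_on_subset by blast
    show "continuous_on (cball w d) f"
      using hol subD holomorphic_on_imp_continuous_on continuous_on_subset by blast
    fix x assume x: "cmod (w - x) = d"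
    then have "x \<in> cball w d" by (simp add: dist_norm)
    then have "cmod x \<le> 1 - d" "x \<in> D" using sub subD by auto
    then have "h2_norm f / sqrt (1 - cmod x) \<le> h2_norm f / sqrt d"
      using d h2_norm_nonneg[OF f] by (intro divide_left_mono) auto
    with h2_growth[OF f \<open>x \<in> D\<close>] show "cmod (f x) \<le> h2_norm f / sqrt d" by linarith
  qed (use d in auto)
  also have "fact 1 * (h2_norm f / sqrt d) / d ^ 1 = h2_norm f * (1/d) powr (3/2)"
  proof -
    have "(1/d) powr (3/2) = (1/d) powr (1 + 1/2)" by simp
    also have "\<dots> = (1/d) * sqrt (1/d)" using d unfolding powr_add by (simp add: powr_half_sqrt)
    finally show ?thesis using d by (simp add: real_sqrt_divide)
  qed
  finally show ?thesis by (simp add: d_def)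
qed

text \<open>The mean value property of Re Q replaces any discussion of boundary values.\<close>
lemma h2_dominated:
  assumes f: "f holomorphic_on D" and Q: "Q holomorphic_on D"
    and ReQ: "\<And>z. z \<in> D \<Longrightarrow> (cmod (Q z))\<^sup>2 \<le> Re (Q z)"
    and le: "\<And>z. z \<in> D \<Longrightarrow> cmod (f z) \<le> K * cmod (Q z)" and K: "0 \<le> K"
  shows "f \<in> hardy2" "h2_norm f \<le> K * sqrt (Re (Q 0))"
proof -
  have m: "h2_mean f r \<le> K\<^sup>2 * Re (Q 0)" if r: "0 \<le> r" "r < 1" for r
  proof (rule h2_mean_le_integral[OF _ r, where u="\<lambda>z. K\<^sup>2 * Re (Q z)"])
    show "continuous_on D f" using f by (rule holomorphic_on_imp_continuous_on)
    show "((\<lambda>t. K\<^sup>2 * Re (Q (complex_of_real r * cis t))) has_integral 2 * pi * (K\<^sup>2 * Re (Q 0))) {0..2 * pi}"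
      using has_integral_mult_right[OF has_integral_linear[OF mean_value_circle[OF Q r] bounded_linear_Re], of "K\<^sup>2"]
      by (simp add: o_def algebra_simps)
    fix z assume z: "z \<in> D"
    have "(cmod (f z))\<^sup>2 \<le> (K * cmod (Q z))\<^sup>2" using le[OF z] by (simp add: power_mono)
    also have "\<dots> \<le> K\<^sup>2 * Re (Q z)" using ReQ[OF z] by (simp add: power_mult_distrib mult_left_mono)
    finally show "(cmod (f z))\<^sup>2 \<le> K\<^sup>2 * Re (Q z)" .
  qed
  have Q0: "0 \<le> Re (Q 0)" using ReQ[of 0] order_trans[OF zero_le_power2] by (simp add: D_def)
  show "f \<in> hardy2" using f m hardy2I by blast
  show "h2_norm f \<le> K * sqrt (Re (Q 0))"
    using m Q0 K by (intro h2_norm_le) (auto simp: power_mult_distrib)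
qed

lemma h2_mean_cong: "(\<And>z. z \<in> D \<Longrightarrow> f z = g z) \<Longrightarrow> 0 \<le> r \<Longrightarrow> r < 1 \<Longrightarrow> h2_mean f r = h2_mean g r"
  by (simp add: h2_mean_def circle_in_D)

lemma h2_norm_cong:
  assumes "\<And>z. z \<in> D \<Longrightarrow> f z = g z"
  shows "h2_norm f = h2_norm g"
proof -
  have "h2_mean f ` {0..<1} = h2_mean g ` {0..<1}"
    by (rule image_cong) (auto intro!: h2_mean_cong assms)
  then show ?thesis by (simp add: h2_norm_def)
qed

section \<open>Parseval's identity on circles and density of polynomials\<close>

lemma cmod_add_square:
  "(cmod (x + y))\<^sup>2 = (cmod x)\<^sup>2 + (cmod y)\<^sup>2 + 2 * Re (cnj x * y)"
  unfolding cmod_power2 by (simp add: power2_eq_square algebra_simps)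

text \<open>The cross term is the real part of a holomorphic function vanishing at 0.\<close>
lemma h2_mean_split:
  assumes g: "g holomorphic_on D" and h: "h holomorphic_on D" and r: "0 \<le> r" "r < 1"
    and eq: "\<And>z. z \<in> D \<Longrightarrow> g z = a + z * h z"
  shows "h2_mean g r = (cmod a)\<^sup>2 + r\<^sup>2 * h2_mean h r"
proof -
  let ?z = "\<lambda>t. complex_of_real r * cis t"
  have "((\<lambda>t. 2 * Re (cnj a * (?z t * h (?z t)))) has_integral 2 * 0) {0..2*pi}"
  proof (rule has_integral_mult_right)
    have "((\<lambda>t. cnj a * (?z t * h (?z t))) has_integral 2 * of_real pi * (cnj a * (0 * h 0))) {0..2*pi}"
      using r h by (intro mean_value_circle[where F="\<lambda>z. cnj a * (z * h z)"] holomorphic_intros)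
    from has_integral_linear[OF this bounded_linear_Re]
    show "((\<lambda>t. Re (cnj a * (?z t * h (?z t)))) has_integral 0) {0..2*pi}"
      by (simp add: o_def)
  qed
  moreover have "((\<lambda>t. (cmod a)\<^sup>2) has_integral 2 * pi * (cmod a)\<^sup>2) {0..2*pi}"
    using has_integral_const_real[of "(cmod a)\<^sup>2" 0 "2*pi"] by simp
  moreover have "((\<lambda>t. r\<^sup>2 * (cmod (h (?z t)))\<^sup>2) has_integral r\<^sup>2 * (2 * pi * h2_mean h r)) {0..2*pi}"
    by (intro has_integral_mult_right has_integral_h2_mean holomorphic_on_imp_continuous_on h r)
  ultimately have "((\<lambda>t. (cmod a)\<^sup>2 + r\<^sup>2 * (cmod (h (?z t)))\<^sup>2 + 2 * Re (cnj a * (?z t * h (?z t))))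
     has_integral 2 * pi * (cmod a)\<^sup>2 + r\<^sup>2 * (2 * pi * h2_mean h r) + 2 * 0) {0..2*pi}"
    by (intro has_integral_add)
  moreover have "(\<lambda>t. (cmod (g (?z t)))\<^sup>2) =
      (\<lambda>t. (cmod a)\<^sup>2 + r\<^sup>2 * (cmod (h (?z t)))\<^sup>2 + 2 * Re (cnj a * (?z t * h (?z t))))"
    using eq[OF circle_in_D[OF r]] cmod_add_square[of a]
    by (simp add: norm_mult power_mult_distrib)
  moreover have "2 * pi * (cmod a)\<^sup>2 + r\<^sup>2 * (2 * pi * h2_mean h r) + 2 * 0 =
       2 * pi * ((cmod a)\<^sup>2 + r\<^sup>2 * h2_mean h r)" by (simp add: algebra_simps)
  ultimately have "((\<lambda>t. (cmod (g (?z t)))\<^sup>2) has_integral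
       2 * pi * ((cmod a)\<^sup>2 + r\<^sup>2 * h2_mean h r)) {0..2*pi}"
    by simp
  then have "integral {0..2*pi} (\<lambda>t. (cmod (g (?z t)))\<^sup>2) = 2 * pi * ((cmod a)\<^sup>2 + r\<^sup>2 * h2_mean h r)"
    by (rule integral_unique)
  then show ?thesis by (simp add: h2_mean_def)
qed

text \<open>Parseval's identity, obtained by peeling off one coefficient at a time with
  \<open>h2_mean_split\<close>. The function \<open>g N\<close> below is the N-fold backward shift
  of \<open>f\<close>, so the Taylor remainder is \<open>z ^ N * g N z\<close>; its mean tends to 0
  by uniform convergence of the Taylor series on the circle.\<close>

lemma h2_mean_Taylor:
  assumes f: "f holomorphic_on D"
  defines "c \<equiv> \<lambda>n. (deriv ^^ n) f 0 / fact n"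
  assumes r: "0 \<le> r" "r < 1"
  shows "(\<lambda>n. (cmod (c n))\<^sup>2 * (r\<^sup>2) ^ n) sums h2_mean f r"
    and "h2_mean (\<lambda>z. f z - (\<Sum>i<N. c i * z ^ i)) r = h2_mean f r - (\<Sum>n<N. (cmod (c n))\<^sup>2 * (r\<^sup>2) ^ n)"
proof -
  have sums: "(\<lambda>n. c n * z ^ n) sums f z" if "z \<in> D" for z
    using holomorphic_power_series[of f 0 1 z] f that by (simp add: D_def c_def)
  define g where "g N z = (\<Sum>n. c (n + N) * z ^ n)" for N z
  have gsum: "(\<lambda>n. c (n + N) * z ^ n) sums g N z" if z: "z \<in> D" for N z
  proof -
    have "summable (\<lambda>n. c (n + N) * z ^ n)"
    \<comment> \<open>The shifted series is a tail of the Taylor series divided by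
      \<open>z ^ N\<close>.\<close>
    proof (cases "z = 0")
      case True
      then show ?thesis by (simp add: summable_zero_power')
    next
      case False
      have "summable (\<lambda>n. c (n + N) * z ^ (n + N))"
        using sums[OF z] by (subst summable_iff_shift) (auto simp: sums_iff)
      then have "summable (\<lambda>n. c (n + N) * z ^ (n + N) / z ^ N)" by (rule summable_divide)
      then show ?thesis using False by (simp add: power_add)
    qed
    then show ?thesis unfolding g_def by (simp add: summable_sums)
  qed
  have ghol: "g N holomorphic_on D" for N
    unfolding D_def using gsum by (intro power_series_holomorphic[where a="\<lambda>n. c (n + N)"]) (simp add: D_def)
  have gstep: "g N z = c N + z * g (Suc N) z" if "z \<in> D" for N z
  proof -
    have "(\<lambda>n. c (Suc n + N) * z ^ (Suc n)) sums (z * g (Suc N) z)"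
      using sums_mult[OF gsum[OF that, of "Suc N"], of z] by (simp add: ac_simps)
    then have "(\<lambda>n. c (n + N) * z ^ n) sums (z * g (Suc N) z + c N)"
      by (subst (asm) sums_Suc_iff) simp
    then show ?thesis using gsum[OF that, of N] sums_unique2 by (metis add.commute)
  qed
  have fg: "f z - (\<Sum>i<N. c i * z ^ i) = z ^ N * g N z" if "z \<in> D" for N z
  proof (induction N)
    case 0
    then show ?case using gsum[OF that, of 0] sums[OF that] sums_unique2 by auto
  next
    case (Suc N)
    then show ?case using gstep[OF that, of N] by (simp add: algebra_simps)
  qed
  have mean: "h2_mean f r = (\<Sum>n<N. (cmod (c n))\<^sup>2 * (r\<^sup>2) ^ n) + (r\<^sup>2) ^ N * h2_mean (g N) r" for N
  proof (induction N)
    case 0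
    then show ?case using h2_mean_cong[of f "g 0" r] fg[of _ 0] r by simp
  next
    case (Suc N)
    then show ?case using h2_mean_split[OF ghol ghol r gstep, of N]
      by (simp add: algebra_simps)
  qed
  have rem: "h2_mean (\<lambda>z. f z - (\<Sum>i<N. c i * z ^ i)) r = (r\<^sup>2) ^ N * h2_mean (g N) r" for N
  proof -
    have "h2_mean (\<lambda>z. f z - (\<Sum>i<N. c i * z ^ i)) r = h2_mean (\<lambda>z. z ^ N * g N z) r"
      by (rule h2_mean_cong[OF fg r])
    also have "\<dots> = (r\<^sup>2) ^ N * h2_mean (g N) r"
      using r by (simp add: h2_mean_def norm_mult norm_power power_mult_distrib flip: power_mult)
         (simp add: mult.commute)
    finally show ?thesis .
  qed
  show "h2_mean (\<lambda>z. f z - (\<Sum>i<N. c i * z ^ i)) r = h2_mean f r - (\<Sum>n<N. (cmod (c n))\<^sup>2 * (r\<^sup>2) ^ n)"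
    using rem mean[of N] by simp
  have "(\<lambda>N. \<Sum>n<N. (cmod (c n))\<^sup>2 * (r\<^sup>2) ^ n) \<longlonglongrightarrow> h2_mean f r"
  proof (rule LIMSEQ_I)
    fix e :: real assume e: "0 < e"
    \<comment> \<open>Convergence at a radius strictly between \<open>r\<close> and 1 places the
      radius of convergence above \<open>r\<close>.\<close>
    define s where "s = (1 + r) / 2"
    have s: "r < s" "s < 1" "0 < s" using r by (auto simp: s_def)
    have "summable (\<lambda>n. c n * complex_of_real s ^ n)"
      using sums[of "complex_of_real s"] s by (auto simp: D_def sums_iff)
    then have "ereal s \<le> conv_radius c" using conv_radius_geI[of c "complex_of_real s"] s by simp
    then have "ereal r < conv_radius c" using s by (metis ereal_less_eq(3) less_ereal.simps(1) not_le order_less_le_trans)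
    from powser_uniform_limit[OF this, of 0] have
      "uniform_limit (cball 0 r) (\<lambda>n x. \<Sum>i<n. c i * x ^ i) (\<lambda>x. suminf (\<lambda>i. c i * x ^ i)) sequentially"
      by simp
    then have "\<forall>\<^sub>F N in sequentially. \<forall>x\<in>cball 0 r. dist (\<Sum>i<N. c i * x ^ i) (suminf (\<lambda>i. c i * x ^ i)) < sqrt (e/2)"
      using e by (auto simp: uniform_limit_iff)
    then obtain M where "\<forall>N\<ge>M. \<forall>x\<in>cball 0 r.
        dist (\<Sum>i<N. c i * x ^ i) (suminf (\<lambda>i. c i * x ^ i)) < sqrt (e/2)"
      unfolding eventually_sequentially by blast
    then have M: "dist (\<Sum>i<N. c i * x ^ i) (suminf (\<lambda>i. c i * x ^ i)) < sqrt (e/2)"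
      if "N \<ge> M" "cmod x \<le> r" for N x
      using that by simp
    have "norm ((\<Sum>n<N. (cmod (c n))\<^sup>2 * (r\<^sup>2) ^ n) - h2_mean f r) < e" if N: "N \<ge> M" for N
    proof -
      let ?d = "\<lambda>z. f z - (\<Sum>i<N. c i * z ^ i)"
      have cont: "continuous_on D ?d"
        by (intro continuous_intros holomorphic_on_imp_continuous_on f)
      have le: "(cmod (?d (complex_of_real r * cis t)))\<^sup>2 \<le> e / 2" for t
      proof -
        have "cmod (?d (complex_of_real r * cis t)) \<le> sqrt (e/2)"
          using M[OF N, of "complex_of_real r * cis t"] r sums[OF circle_in_D[OF r, of t]]
          by (simp add: dist_norm norm_mult norm_minus_commute sums_iff)
        then have "(cmod (?d (complex_of_real r * cis t)))\<^sup>2 \<le> (sqrt (e/2))\<^sup>2"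
          by (rule power_mono) simp
        then show ?thesis using e by simp
      qed
      have "2 * pi * h2_mean ?d r \<le> 2 * pi * (e / 2)"
      proof (rule has_integral_le[OF has_integral_h2_mean[OF cont r]])
        show "((\<lambda>t. e / 2) has_integral 2 * pi * (e / 2)) {0..2 * pi}"
          using has_integral_const_real[of "e/2" 0 "2*pi"] by simp
      qed (rule le)
      then have "h2_mean ?d r \<le> e / 2" by simp
      moreover have "0 \<le> h2_mean ?d r" by (rule h2_mean_nonneg)
      ultimately show ?thesis using rem[of N] mean[of N] e by simp
    qed
    then show "\<exists>M. \<forall>N\<ge>M. norm ((\<Sum>n<N. (cmod (c n))\<^sup>2 * (r\<^sup>2) ^ n) - h2_mean f r) < e" by blast
  qed
  then show "(\<lambda>n. (cmod (c n))\<^sup>2 * (r\<^sup>2) ^ n) sums h2_mean f r" by (simp add: sums_def)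
qed

text \<open>Letting r tend to 1 in the partial sums of Parseval's identity shows that the squared
  coefficients are summable. Their tail then bounds the mean of the Taylor remainder for every r at
  once.\<close>

lemma polynomials_dense_hardy2:
  assumes f: "f \<in> hardy2" and e: "0 < e"
  obtains c :: "nat \<Rightarrow> complex" and N where
    "(\<lambda>z. \<Sum>i<N. c i * z ^ i) \<in> hardy2" "h2_norm (\<lambda>z. f z - (\<Sum>i<N. c i * z ^ i)) < e"
proof -
  have hol: "f holomorphic_on D" using f by (simp add: hardy2_def)
  define c where "c n = (deriv ^^ n) f 0 / fact n" for n
  note T = h2_mean_Taylor[OF hol, folded c_def]
  have part: "(\<Sum>n<N. (cmod (c n))\<^sup>2) \<le> (h2_norm f)\<^sup>2" for N
  proof (rule tendsto_upperbound)
    have "((\<lambda>r. \<Sum>n<N. (cmod (c n))\<^sup>2 * (r\<^sup>2) ^ n) \<longlongrightarrow> (\<Sum>n<N. (cmod (c n))\<^sup>2 * (1\<^sup>2) ^ n)) (at_left (1::real))"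
      by (intro tendsto_intros)
    then show "((\<lambda>r. \<Sum>n<N. (cmod (c n))\<^sup>2 * (r\<^sup>2) ^ n) \<longlongrightarrow> (\<Sum>n<N. (cmod (c n))\<^sup>2)) (at_left (1::real))"
      by simp
    show "\<forall>\<^sub>F r in at_left (1::real). (\<Sum>n<N. (cmod (c n))\<^sup>2 * (r\<^sup>2) ^ n) \<le> (h2_norm f)\<^sup>2"
      using eventually_at_left_real[OF zero_less_one[where 'a=real]]
    proof eventually_elim
      case (elim r)
      then have "(\<Sum>n<N. (cmod (c n))\<^sup>2 * (r\<^sup>2) ^ n) \<le> h2_mean f r"
        using T(1)[of r] sum_le_suminf[of "\<lambda>n. (cmod (c n))\<^sup>2 * (r\<^sup>2) ^ n" "{..<N}"]
        by (auto simp: sums_iff)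
      also have "\<dots> \<le> (h2_norm f)\<^sup>2" using h2_mean_le_norm[OF f] elim by auto
      finally show ?case .
    qed
  qed simp
  have summ: "summable (\<lambda>n. (cmod (c n))\<^sup>2)"
    using part by (intro summableI_nonneg_bounded) auto
  have "(\<lambda>N. \<Sum>n. (cmod (c (n + N)))\<^sup>2) \<longlonglongrightarrow> 0"
    using suminf_exist_split2[OF summ] .
  then obtain N where N: "(\<Sum>n. (cmod (c (n + N)))\<^sup>2) < (e/2)\<^sup>2"
    using e order_tendstoD(2)[of _ 0 sequentially "(e/2)\<^sup>2"]
    by (fastforce simp: eventually_sequentially)
  let ?p = "\<lambda>z. \<Sum>i<N. c i * z ^ i"
  have p: "?p \<in> hardy2"
  proof (rule bounded_hardy2)
    show "?p holomorphic_on D" by (intro holomorphic_intros)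
    show "cmod (?p z) \<le> (\<Sum>i<N. cmod (c i))" if "z \<in> D" for z
      using that by (intro sum_norm_le) (auto simp: D_def norm_mult norm_power mult_left_le power_le_one)
  qed
  have "h2_norm (\<lambda>z. f z - ?p z) \<le> e/2"
  proof (rule h2_norm_le)
    fix r :: real assume r: "0 \<le> r" "r < 1"
    have s: "summable (\<lambda>n. (cmod (c n))\<^sup>2 * (r\<^sup>2) ^ n)" using T(1)[OF r] by (simp add: sums_iff)
    have "h2_mean (\<lambda>z. f z - ?p z) r = (\<Sum>n. (cmod (c n))\<^sup>2 * (r\<^sup>2) ^ n) - (\<Sum>n<N. (cmod (c n))\<^sup>2 * (r\<^sup>2) ^ n)"
      using T[OF r] by (simp add: sums_iff)
    also have "\<dots> = (\<Sum>n. (cmod (c (n + N)))\<^sup>2 * (r\<^sup>2) ^ (n + N))"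
      using suminf_minus_initial_segment[OF s, of N] by simp
    also have "\<dots> \<le> (\<Sum>n. (cmod (c (n + N)))\<^sup>2)"
    proof (rule suminf_le)
      show "summable (\<lambda>n. (cmod (c (n + N)))\<^sup>2 * (r\<^sup>2) ^ (n + N))"
        using s summable_iff_shift[of "\<lambda>n. (cmod (c n))\<^sup>2 * (r\<^sup>2) ^ n"] by simp
      show "summable (\<lambda>n. (cmod (c (n + N)))\<^sup>2)" using summ by (subst summable_iff_shift)
      show "(cmod (c (n + N)))\<^sup>2 * (r\<^sup>2) ^ (n + N) \<le> (cmod (c (n + N)))\<^sup>2" for n
        using r by (intro mult_left_le power_le_one) (auto simp: power_le_one)
    qed
    finally show "h2_mean (\<lambda>z. f z - ?p z) r \<le> (e/2)\<^sup>2" using N by simp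
  qed (use e in simp)
  with p e that show ?thesis by fastforce
qed

section \<open>Recurrence, and maps with an interior fixed point\<close>

lemma comp_op_power: "(comp_op \<phi> ^^ k) f = f \<circ> (\<phi> ^^ k)"
proof (induction k)
  case (Suc k)
  have "\<phi> ^^ Suc k = \<phi> ^^ k \<circ> \<phi>" by (rule funpow_Suc_right)
  then show ?case using Suc by (simp add: comp_op_def o_assoc del: funpow.simps(2)) (simp add: comp_op_def o_assoc)
qed simp

lemma funpow_in_D: "\<phi> ` D \<subseteq> D \<Longrightarrow> z \<in> D \<Longrightarrow> (\<phi> ^^ n) z \<in> D"
  by (induction n) auto

lemma funpow_holomorphic:
  assumes "\<phi> holomorphic_on D" "\<phi> ` D \<subseteq> D"
  shows "(\<phi> ^^ n) holomorphic_on D"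
proof (induction n)
  case 0
  show ?case by (simp add: id_def)
next
  case (Suc n)
  have "(\<phi> \<circ> \<phi> ^^ n) holomorphic_on D"
    using Suc by (rule holomorphic_on_compose_gen[OF _ assms(1)]) (use funpow_in_D[OF assms(2)] in auto)
  then show ?case by (simp add: o_def)
qed

text \<open>An \<open>h2_open\<close> set contains a ball around each of its points, but only the
  members of \<open>hardy2\<close> in that ball; hence the explicit demand that the iterate lie in
  \<open>hardy2\<close>.\<close>

lemma h2_recurrentI:
  assumes "\<And>f e. f \<in> hardy2 \<Longrightarrow> 0 < e \<Longrightarrow> \<exists>k>0. \<exists>h\<in>hardy2. (T ^^ k) h \<in> hardy2 \<and>
     h2_norm (\<lambda>z. h z - f z) < e \<and> h2_norm (\<lambda>z. (T ^^ k) h z - f z) < e"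
  shows "h2_recurrent T"
  unfolding h2_recurrent_def
proof (intro allI impI)
  fix U assume U: "h2_open U \<and> U \<noteq> {}"
  then obtain f where f: "f \<in> U" by blast
  then obtain e where e: "e > 0" and ball: "\<And>g. g \<in> hardy2 \<Longrightarrow> h2_norm (\<lambda>z. g z - f z) < e \<Longrightarrow> g \<in> U"
    using U unfolding h2_open_def by blast
  have "f \<in> hardy2" using U f unfolding h2_open_def by blast
  from assms[OF this e] ball show "\<exists>k>0. \<exists>f\<in>U. (T ^^ k) f \<in> U" by metis
qed

lemma h2_open_ball:
  assumes f: "f \<in> hardy2"
  shows "h2_open {g \<in> hardy2. h2_norm (\<lambda>z. g z - f z) < e}"
  unfolding h2_open_def
proof (intro conjI ballI)
  fix g assume g: "g \<in> {g \<in> hardy2. h2_norm (\<lambda>z. g z - f z) < e}"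
  show "\<exists>d>0. \<forall>h\<in>hardy2. h2_norm (\<lambda>z. h z - g z) < d \<longrightarrow> h \<in> {g \<in> hardy2. h2_norm (\<lambda>z. g z - f z) < e}"
  proof (intro exI[of _ "e - h2_norm (\<lambda>z. g z - f z)"] conjI ballI impI)
    fix h assume h: "h \<in> hardy2" "h2_norm (\<lambda>z. h z - g z) < e - h2_norm (\<lambda>z. g z - f z)"
    then show "h \<in> {g \<in> hardy2. h2_norm (\<lambda>z. g z - f z) < e}"
      using h2_norm_diff_triangle[of h g f] f g by auto
  qed (use g in auto)
qed auto

section \<open>Maps with a fixed point in the disc\<close>

lemma identity_hardy2: "(\<lambda>z. z) \<in> hardy2"
  by (rule bounded_hardy2[of _ 1]) (auto simp: D_def intro: holomorphic_intros)

lemma not_recurrent_interior: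
  assumes hol: "\<phi> holomorphic_on D" and sub: "\<phi> ` D \<subseteq> D"
    and p: "p \<in> D" "\<phi> p = p" and less: "cmod (deriv \<phi> p) < 1"
  shows "\<not> h2_recurrent (comp_op \<phi>)"
proof
  assume rec: "h2_recurrent (comp_op \<phi>)"
  define \<kappa> where "\<kappa> = deriv \<phi> p"
  \<comment> \<open>Chosen so that (1 + e) |\<kappa>| = (1 + e)(1 - 2e) <= 1 - e: a derivative
    within e of 1 at p is pushed out of that range by one factor \<kappa>, and by more factors all
    the more.\<close>
  define e where "e = (1 - cmod \<kappa>) / 2"
  have e: "0 < e" "e \<le> 1/2" using less by (auto simp: e_def \<kappa>_def)
  define C where "C = (2 / (1 - cmod p)) powr (3/2)"
  have C: "0 < C" using p by (simp add: C_def D_def)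
  have D: "open D" by (simp add: D_def)
  have dbound: "cmod (deriv f p) \<le> h2_norm f * C" if "f \<in> hardy2" for f
    using h2_deriv_bound[OF that, of "cmod p" p] p by (simp add: D_def C_def)
  \<comment> \<open>Open because \<open>h2_deriv_bound\<close> makes the derivative at
    \<open>p\<close> a continuous functional; the identity function shows that it is
    non-empty.\<close>
  let ?U = "{f \<in> hardy2. cmod (deriv f p - 1) < e}"
  have "h2_open ?U"
    unfolding h2_open_def
  proof (intro conjI ballI)
    fix f assume f: "f \<in> ?U"
    show "\<exists>d>0. \<forall>g\<in>hardy2. h2_norm (\<lambda>z. g z - f z) < d \<longrightarrow> g \<in> ?U"
    proof (intro exI[of _ "(e - cmod (deriv f p - 1)) / C"] conjI ballI impI)
      fix g assume g: "g \<in> hardy2" "h2_norm (\<lambda>z. g z - f z) < (e - cmod (deriv f p - 1)) / C"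
      have "deriv (\<lambda>z. g z - f z) p = deriv g p - deriv f p"
        using f g p D by (intro deriv_diff) (auto simp: hardy2_def holomorphic_on_imp_differentiable_at)
      then have "cmod (deriv g p - deriv f p) \<le> h2_norm (\<lambda>z. g z - f z) * C"
        using dbound[OF hardy2_diff[OF g(1), of f]] f by simp
      also have "\<dots> < e - cmod (deriv f p - 1)" using g(2) C by (simp add: field_simps)
      finally have "cmod ((deriv g p - deriv f p) + (deriv f p - 1)) < e"
        by (smt (verit) norm_triangle_ineq)
      then show "g \<in> ?U" using g by simp
    qed (use f C in auto)
  qed auto
  moreover have "(\<lambda>z. z) \<in> ?U" using identity_hardy2 e by simp
  ultimately obtain k f where k: "0 < k" and f: "f \<in> ?U" "(comp_op \<phi> ^^ k) f \<in> ?U"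
    using rec unfolding h2_recurrent_def by blast
  have fix_pow: "(\<phi> ^^ n) p = p" for n by (induction n) (auto simp: p)
  have dphi: "(\<phi> has_field_derivative \<kappa>) (at p)"
    using hol p D unfolding \<kappa>_def by (simp add: holomorphic_derivI)
  have dpow: "((\<phi> ^^ n) has_field_derivative \<kappa> ^ n) (at p)" for n
  proof (induction n)
    case 0
    show ?case by (simp add: id_def)
  next
    case (Suc n)
    have "(\<phi> \<circ> (\<phi> ^^ n) has_field_derivative \<kappa> * \<kappa> ^ n) (at p)"
      using Suc dphi by (intro DERIV_chain) (auto simp: fix_pow)
    then show ?case by (simp add: o_def)
  qed
  have "(f has_field_derivative deriv f p) (at p)"
    using f p D by (auto simp: hardy2_def intro: holomorphic_derivI)
  then have "(f \<circ> (\<phi> ^^ k) has_field_derivative deriv f p * \<kappa> ^ k) (at p)"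
    using dpow by (intro DERIV_chain) (auto simp: fix_pow)
  then have "deriv ((comp_op \<phi> ^^ k) f) p = deriv f p * \<kappa> ^ k"
    by (simp add: comp_op_power DERIV_imp_deriv)
  then have "cmod (deriv f p * \<kappa> ^ k - 1) < e" using f by simp
  then have "1 - e < cmod (deriv f p) * cmod \<kappa> ^ k"
    using norm_triangle_ineq2[of 1 "deriv f p * \<kappa> ^ k"] by (simp add: norm_mult norm_power norm_minus_commute)
  also have "\<dots> \<le> (1 + e) * cmod \<kappa>"
  proof (rule mult_mono)
    show "cmod (deriv f p) \<le> 1 + e"
      using f norm_triangle_ineq2[of "deriv f p" 1] by simp
    show "cmod \<kappa> ^ k \<le> cmod \<kappa>"
      using k less power_decreasing[of 1 k "cmod \<kappa>"] by (simp add: \<kappa>_def)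
  qed (use e in auto)
  also have "cmod \<kappa> = 1 - 2 * e" by (simp add: e_def field_simps)
  also have "(1 + e) * (1 - 2 * e) \<le> 1 - e" using e by (simp add: algebra_simps)
  finally show False by simp
qed

text \<open>By compactness two distinct powers are close to each other, and dividing by the lower
  one changes no distance.\<close>

lemma unimodular_power_near_1:
  fixes \<zeta> :: complex
  assumes "cmod \<zeta> = 1" "0 < d"
  obtains n where "0 < n" "cmod (\<zeta> ^ n - 1) < d"
proof -
  have "bounded (range (\<lambda>n. \<zeta> ^ n))" using assms by (auto simp: bounded_iff norm_power)
  then obtain l r where r: "strict_mono (r :: nat \<Rightarrow> nat)" and lim: "((\<lambda>n. \<zeta> ^ n) \<circ> r) \<longlonglongrightarrow> l"
    using bounded_imp_convergent_subsequence by blast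
  from LIMSEQ_imp_Cauchy[OF lim] obtain M where
    "\<forall>m\<ge>M. \<forall>n\<ge>M. cmod (\<zeta> ^ r m - \<zeta> ^ r n) < d"
    unfolding Cauchy_iff o_def using assms(2) by blast
  then have "cmod (\<zeta> ^ r (Suc M) - \<zeta> ^ r M) < d" by simp
  moreover have lt: "r M < r (Suc M)" using r by (simp add: strict_mono_Suc_iff)
  then have "\<zeta> ^ r (Suc M) - \<zeta> ^ r M = \<zeta> ^ r M * (\<zeta> ^ (r (Suc M) - r M) - 1)"
    by (simp add: algebra_simps flip: power_add)
  ultimately have "cmod (\<zeta> ^ (r (Suc M) - r M) - 1) < d"
    using assms by (simp add: norm_mult norm_power)
  with lt that[of "r (Suc M) - r M"] show ?thesis by simp
qed

text \<open>Conjugation with the disc automorphism that moves \<open>p\<close> to 0 reduces both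
  claims to the Schwarz lemma and its equality case.\<close>

lemma Schwarz_Pick_fixed_point:
  assumes hol: "\<phi> holomorphic_on D" and sub: "\<phi> ` D \<subseteq> D" and p: "p \<in> D" "\<phi> p = p"
  shows "cmod (deriv \<phi> p) \<le> 1"
    and "cmod (deriv \<phi> p) = 1 \<Longrightarrow> \<exists>\<zeta>. cmod \<zeta> = 1 \<and>
       (\<forall>z\<in>D. \<phi> z = Moebius_function 0 (-p) (\<zeta> * Moebius_function 0 p z))"
proof -
  define \<tau> where "\<tau> = Moebius_function 0 p"
  define \<sigma> where "\<sigma> = Moebius_function 0 (-p)"
  have p1: "cmod p < 1" using p by (simp add: D_def)
  have hols: "\<tau> holomorphic_on D" "\<sigma> holomorphic_on D"
    using p1 by (auto simp: D_def \<tau>_def \<sigma>_def intro: Moebius_function_holomorphic)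
  have im: "\<tau> z \<in> D" "\<sigma> z \<in> D" if "z \<in> D" for z
    using p1 that Moebius_function_norm_lt_1 by (auto simp: D_def \<tau>_def \<sigma>_def)
  have inv: "\<tau> (\<sigma> z) = z" "\<sigma> (\<tau> z) = z" if "z \<in> D" for z
    using p1 that Moebius_function_compose by (auto simp: D_def \<tau>_def \<sigma>_def)
  have tp: "\<tau> p = 0" "\<sigma> 0 = p" "0 \<in> D" "open D"
    by (simp_all add: \<tau>_def \<sigma>_def Moebius_function_def D_def)
  define g where "g = \<tau> \<circ> (\<phi> \<circ> \<sigma>)"
  have holg: "g holomorphic_on ball 0 1"
    unfolding g_def D_def[symmetric]
    by (intro holomorphic_on_compose_gen[of _ _ _ D] hols hol) (use sub im in auto)
  have g0: "g 0 = 0" by (simp add: g_def tp p)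
  have gD: "\<And>z. cmod z < 1 \<Longrightarrow> cmod (g z) < 1"
    using im sub by (fastforce simp: g_def D_def)
  \<comment> \<open>The derivatives of the two mutually inverse maps cancel, so conjugation keeps
    the derivative at the fixed point.\<close>
  have "(\<tau> \<circ> \<sigma> has_field_derivative deriv \<tau> p * deriv \<sigma> 0) (at 0)"
    using hols tp p by (intro DERIV_chain) (auto intro: holomorphic_derivI)
  moreover have "(\<tau> \<circ> \<sigma> has_field_derivative 1) (at 0)"
    by (rule has_field_derivative_transform_within_open[OF DERIV_ident tp(4,3)]) (simp add: inv)
  ultimately have one: "deriv \<tau> p * deriv \<sigma> 0 = 1" by (rule DERIV_unique)
  have "(g has_field_derivative deriv \<tau> p * (deriv \<phi> p * deriv \<sigma> 0)) (at 0)"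
    unfolding g_def using hols hol tp p by (intro DERIV_chain) (auto intro: holomorphic_derivI)
  then have dg: "deriv g 0 = deriv \<phi> p" using one by (simp add: DERIV_imp_deriv algebra_simps)
  show "cmod (deriv \<phi> p) \<le> 1"
    using Schwarz_Lemma(2)[OF holg g0 gD, of 0] by (simp add: dg)
  assume "cmod (deriv \<phi> p) = 1"
  then obtain \<zeta> where \<zeta>: "\<And>z. cmod z < 1 \<Longrightarrow> g z = \<zeta> * z" "cmod \<zeta> = 1"
    using Schwarz_Lemma(3)[OF holg g0 gD, of 0] by (auto simp: dg)
  have "\<phi> z = \<sigma> (\<zeta> * \<tau> z)" if z: "z \<in> D" for z
  proof -
    have "\<tau> (\<phi> z) = \<zeta> * \<tau> z" using \<zeta>(1)[of "\<tau> z"] im[OF z] inv z by (simp add: g_def D_def)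
    moreover have "\<phi> z \<in> D" using sub z by blast
    ultimately show ?thesis using inv by metis
  qed
  with \<zeta> show "\<exists>\<zeta>. cmod \<zeta> = 1 \<and> (\<forall>z\<in>D. \<phi> z = Moebius_function 0 (-p) (\<zeta> * Moebius_function 0 p z))"
    unfolding \<sigma>_def \<tau>_def by blast
qed

text \<open>When \<open>\<zeta> ^ n\<close> is near 1, the iterate is uniformly close to the
  identity on the disc. A polynomial \<open>q\<close> is then close to its own image in the supremum
  norm, hence in \<open>h2_norm\<close>, and is itself the returning vector.\<close>

lemma conjugate_rotation:
  assumes p: "p \<in> D" and \<zeta>: "cmod \<zeta> = 1"
    and \<phi>: "\<And>z. z \<in> D \<Longrightarrow> \<phi> z = Moebius_function 0 (-p) (\<zeta> * Moebius_function 0 p z)"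
  shows "\<phi> ` D = D" and "h2_recurrent (comp_op \<phi>)"
proof -
  define \<tau> where "\<tau> = Moebius_function 0 p"
  define \<sigma> where "\<sigma> = Moebius_function 0 (-p)"
  have p1: "cmod p < 1" using p by (simp add: D_def)
  have im: "\<tau> z \<in> D" "\<sigma> z \<in> D" if "z \<in> D" for z
    using p1 that Moebius_function_norm_lt_1 by (auto simp: D_def \<tau>_def \<sigma>_def)
  have inv: "\<tau> (\<sigma> z) = z" "\<sigma> (\<tau> z) = z" if "z \<in> D" for z
    using p1 that Moebius_function_compose by (auto simp: D_def \<tau>_def \<sigma>_def)
  have rot: "\<xi> * z \<in> D" if "z \<in> D" "cmod \<xi> = 1" for \<xi> z using that by (simp add: D_def norm_mult)
  have phi: "\<phi> z = \<sigma> (\<zeta> * \<tau> z)" if "z \<in> D" for z using \<phi> that by (simp add: \<sigma>_def \<tau>_def)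
  have "y \<in> \<phi> ` D" if y: "y \<in> D" for y
  proof
    let ?x = "\<sigma> (inverse \<zeta> * \<tau> y)"
    have x: "inverse \<zeta> * \<tau> y \<in> D" using im y \<zeta> by (intro rot) (auto simp: norm_inverse)
    then show "?x \<in> D" using im by blast
    have "\<zeta> \<noteq> 0" using \<zeta> by auto
    then show "y = \<phi> ?x" using x y im inv phi by (simp flip: mult.assoc)
  qed
  moreover have self: "\<phi> ` D \<subseteq> D" using phi rot im \<zeta> by auto
  ultimately show "\<phi> ` D = D" by blast
  have pow: "(\<phi> ^^ n) z = \<sigma> (\<zeta> ^ n * \<tau> z)" if z: "z \<in> D" for n z
  proof (induction n)
    case 0
    then show ?case using inv z by simp
  next
    case (Suc n)
    have "\<zeta> ^ n * \<tau> z \<in> D" using z im \<zeta> by (intro rot) (auto simp: norm_power)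
    then show ?case using Suc phi im inv by (simp add: mult.assoc)
  qed
  \<comment> \<open>The denominator of \<open>\<sigma>\<close> has no zero on the closed disc, where
    compactness then gives uniform continuity of \<open>q\<close> composed with
    \<open>\<sigma>\<close>.\<close>
  have "1 + cnj p * w \<noteq> 0" if "cmod w \<le> 1" for w
  proof
    assume "1 + cnj p * w = 0"
    then have "cmod (cnj p * w) = 1" by (metis add.inverse_unique norm_minus_cancel norm_one)
    moreover have "cmod p * cmod w \<le> cmod p" using that by (simp add: mult_left_le)
    ultimately show False using p1 by (simp add: norm_mult)
  qed
  then have cont\<sigma>: "continuous_on (cball 0 1) \<sigma>"
    unfolding \<sigma>_def Moebius_function_simple by (intro continuous_intros) auto
  show "h2_recurrent (comp_op \<phi>)"
  proof (rule h2_recurrentI)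
    fix f and e :: real assume f: "f \<in> hardy2" and e: "0 < e"
    obtain c :: "nat \<Rightarrow> complex" and N where q: "(\<lambda>z. \<Sum>i<N. c i * z ^ i) \<in> hardy2"
      and near: "h2_norm (\<lambda>z. f z - (\<Sum>i<N. c i * z ^ i)) < e/2"
      using polynomials_dense_hardy2[OF f, of "e/2"] e by auto
    define q where "q z = (\<Sum>i<N. c i * z ^ i)" for z
    have "continuous_on (cball 0 1) (\<lambda>w. q (\<sigma> w))"
      unfolding q_def by (intro continuous_intros cont\<sigma>)
    then have "uniformly_continuous_on (cball 0 1) (\<lambda>w. q (\<sigma> w))"
      using compact_uniformly_continuous compact_cball by blast
    then obtain d where d: "0 < d" and ud: "\<And>u w. cmod u \<le> 1 \<Longrightarrow> cmod w \<le> 1 \<Longrightarrow> dist u w < d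
        \<Longrightarrow> dist (q (\<sigma> u)) (q (\<sigma> w)) < e/2"
      unfolding uniformly_continuous_on_def using e by (metis half_gt_zero mem_cball_0)
    obtain n where n: "0 < n" "cmod (\<zeta> ^ n - 1) < d"
      using unimodular_power_near_1[OF \<zeta> d] by blast
    have q2: "q \<in> hardy2" using q by (simp add: q_def[abs_def])
    have holpow: "(\<phi> ^^ n) holomorphic_on D"
    proof (rule funpow_holomorphic[OF _ self])
      have "(\<lambda>z. \<sigma> (\<zeta> * \<tau> z)) holomorphic_on D"
        by (rule holomorphic_on_compose_gen[of "\<lambda>z. \<zeta> * \<tau> z" D \<sigma> D, unfolded o_def])
           (use p1 rot im \<zeta> in \<open>auto simp: D_def \<tau>_def \<sigma>_def intro!: holomorphic_intros Moebius_function_holomorphic\<close>)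
      then show "\<phi> holomorphic_on D" by (rule holomorphic_transform) (simp add: phi)
    qed
    have diff: "cmod (q ((\<phi> ^^ n) z) - q z) \<le> e/2" if z: "z \<in> D" for z
    proof -
      have "cmod (\<tau> z) < 1" using im[OF z] by (simp add: D_def)
      moreover have "\<zeta> ^ n * \<tau> z - \<tau> z = (\<zeta> ^ n - 1) * \<tau> z" by (simp add: algebra_simps)
      ultimately have "dist (\<zeta> ^ n * \<tau> z) (\<tau> z) < d"
        using n d mult_left_le[of "cmod (\<tau> z)" "cmod (\<zeta> ^ n - 1)"] by (simp add: dist_norm norm_mult)
      then have "dist (q (\<sigma> (\<zeta> ^ n * \<tau> z))) (q (\<sigma> (\<tau> z))) < e/2"
        using \<open>cmod (\<tau> z) < 1\<close> \<zeta> by (intro ud) (auto simp: norm_mult norm_power)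
      then show ?thesis using pow[OF z] inv z by (simp add: dist_norm)
    qed
    let ?Tq = "(comp_op \<phi> ^^ n) q"
    have Tq: "?Tq = (\<lambda>z. q ((\<phi> ^^ n) z))" by (simp add: comp_op_power o_def)
    have hold: "(\<lambda>z. ?Tq z - q z) holomorphic_on D"
      unfolding Tq q_def by (intro holomorphic_intros holpow)
    have d2: "(\<lambda>z. ?Tq z - q z) \<in> hardy2" "h2_norm (\<lambda>z. ?Tq z - q z) \<le> e/2"
      using bounded_hardy2[OF hold, of "e/2"] diff by (auto simp: Tq)
    have T2: "?Tq \<in> hardy2" using hardy2_add[OF d2(1) q2] by simp
    have near': "h2_norm (\<lambda>z. q z - f z) < e/2"
      using near h2_norm_diff_commute[of q f] by (simp add: q_def)
    have "h2_norm (\<lambda>z. ?Tq z - f z) < e"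
      using h2_norm_diff_triangle[OF T2 q2 f] d2 near' by simp
    then show "\<exists>k>0. \<exists>h\<in>hardy2. (comp_op \<phi> ^^ k) h \<in> hardy2 \<and>
       h2_norm (\<lambda>z. h z - f z) < e \<and> h2_norm (\<lambda>z. (comp_op \<phi> ^^ k) h z - f z) < e"
      using n q2 T2 near' e by (intro exI[of _ n] conjI bexI[of _ q]) auto
  qed
qed

text \<open>The inverse map also fixes \<open>p\<close> and maps the disc into itself. Both
  derivatives have modulus at most 1 and their product is 1.\<close>

lemma automorphism_deriv_fixed_point:
  assumes hol: "\<phi> holomorphic_on D" and inj: "inj_on \<phi> D" and onto: "\<phi> ` D = D"
    and p: "p \<in> D" "\<phi> p = p"
  shows "cmod (deriv \<phi> p) = 1"
proof -
  have "open D" by (simp add: D_def)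
  then obtain g where hol_g: "g holomorphic_on \<phi> ` D"
    and deriv_g: "\<And>z. z \<in> D \<Longrightarrow> deriv \<phi> z * deriv g (\<phi> z) = 1"
    and g: "\<And>z. z \<in> D \<Longrightarrow> g (\<phi> z) = z"
    using holomorphic_has_inverse[OF hol _ inj] by blast
  have "g ` \<phi> ` D \<subseteq> D" using g by auto
  then have "g ` D \<subseteq> D" by (simp only: onto)
  then have "cmod (deriv g p) \<le> 1"
    using Schwarz_Pick_fixed_point(1)[of g p] hol_g g[of p] p onto by simp
  moreover have "cmod (deriv \<phi> p) \<le> 1"
    using Schwarz_Pick_fixed_point(1) hol onto p by blast
  moreover have "cmod (deriv \<phi> p) * cmod (deriv g p) = 1" 
    using deriv_g[OF p(1)] p by (simp flip: norm_mult)
  ultimately show ?thesis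
    using mult_left_le[of "cmod (deriv g p)" "cmod (deriv \<phi> p)"] by simp
qed

text \<open>Both sides are equivalent to \<open>cmod (deriv \<phi> p) = 1\<close>, the equality case
  of the Schwarz bound.\<close>

theorem recurrent_iff_automorphism_fixed_point:
  assumes hol: "\<phi> holomorphic_on D" and inj: "inj_on \<phi> D" and sub: "\<phi> ` D \<subseteq> D"
    and p: "p \<in> D" "\<phi> p = p"
  shows "h2_recurrent (comp_op \<phi>) \<longleftrightarrow> \<phi> ` D = D"
proof (cases "cmod (deriv \<phi> p) = 1")
  case True
  then obtain \<zeta> where "cmod \<zeta> = 1"
    "\<And>z. z \<in> D \<Longrightarrow> \<phi> z = Moebius_function 0 (-p) (\<zeta> * Moebius_function 0 p z)"
    using Schwarz_Pick_fixed_point(2)[OF hol sub p] by blast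
  from conjugate_rotation[OF p(1) this] show ?thesis by blast
next
  case False
  then have "cmod (deriv \<phi> p) < 1" using Schwarz_Pick_fixed_point(1)[OF hol sub p] by linarith
  then show ?thesis
    using False not_recurrent_interior[OF hol sub p] automorphism_deriv_fixed_point[OF hol inj _ p] by blast
qed

section \<open>Half-plane coordinates\<close>

lemma hardy2_cong:
  assumes "\<And>z. z \<in> D \<Longrightarrow> f z = g z"
  shows "f \<in> hardy2 \<longleftrightarrow> g \<in> hardy2"
proof -
  have "h2_mean f ` {0..<1} = h2_mean g ` {0..<1}"
    by (rule image_cong) (auto intro!: h2_mean_cong assms)
  moreover have "f holomorphic_on D \<longleftrightarrow> g holomorphic_on D" by (rule holomorphic_cong) (auto simp: assms)
  ultimately show ?thesis by (simp add: hardy2_def)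
qed

text \<open>As in the hypercyclicity criterion, the vector g + s witnesses recurrence near g.\<close>
lemma recurrence_criterion:
  assumes sub: "\<phi> ` D \<subseteq> D"
    and *: "\<And>f e. f \<in> hardy2 \<Longrightarrow> 0 < e \<Longrightarrow> \<exists>g\<in>hardy2. h2_norm (\<lambda>z. g z - f z) < e \<and>
       (\<exists>n>0. \<exists>t\<in>hardy2. \<exists>s\<in>hardy2. h2_norm t < e \<and> h2_norm s < e \<and>
          (\<forall>z\<in>D. t z = g ((\<phi> ^^ n) z) \<and> s ((\<phi> ^^ n) z) = g z))"
  shows "h2_recurrent (comp_op \<phi>)"
proof (rule h2_recurrentI)
  fix f and e :: real assume f: "f \<in> hardy2" and e: "0 < e"
  from e have "0 < e/2" by simp
  from *[OF f this] obtain g n t s where g: "g \<in> hardy2" "h2_norm (\<lambda>z. g z - f z) < e/2"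
    and n: "n > 0" and t: "t \<in> hardy2" "h2_norm t < e/2" and s: "s \<in> hardy2" "h2_norm s < e/2"
    and eq: "\<And>z. z \<in> D \<Longrightarrow> t z = g ((\<phi> ^^ n) z)" "\<And>z. z \<in> D \<Longrightarrow> s ((\<phi> ^^ n) z) = g z"
    by blast
  let ?h = "\<lambda>z. g z + s z"
  \<comment> \<open>Composition with the iterate sends \<open>g\<close> to \<open>t\<close> and
    \<open>s\<close> to \<open>g\<close>, so both g + s and its image differ from \<open>g\<close>
    by a small function.\<close>
  have Th: "(comp_op \<phi> ^^ n) ?h z = t z + g z" if "z \<in> D" for z
    using eq[OF that] by (simp add: comp_op_power)
  have gf: "(\<lambda>z. g z - f z) \<in> hardy2" using g f by (intro hardy2_diff)
  have "h2_norm (\<lambda>z. ?h z - f z) = h2_norm (\<lambda>z. (g z - f z) + s z)"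
    by (simp add: algebra_simps)
  then have 1: "h2_norm (\<lambda>z. ?h z - f z) < e"
    using h2_norm_triangle[OF gf s(1)] g s by simp
  have "h2_norm (\<lambda>z. (comp_op \<phi> ^^ n) ?h z - f z) = h2_norm (\<lambda>z. (g z - f z) + t z)"
    by (rule h2_norm_cong) (simp add: Th)
  then have 2: "h2_norm (\<lambda>z. (comp_op \<phi> ^^ n) ?h z - f z) < e"
    using h2_norm_triangle[OF gf t(1)] g t by simp
  have 3: "(comp_op \<phi> ^^ n) ?h \<in> hardy2"
    using hardy2_add[OF t(1) g(1)] hardy2_cong[of "(comp_op \<phi> ^^ n) ?h" "\<lambda>z. t z + g z", OF Th] by blast
  show "\<exists>k>0. \<exists>h\<in>hardy2. (comp_op \<phi> ^^ k) h \<in> hardy2 \<and>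
       h2_norm (\<lambda>z. h z - f z) < e \<and> h2_norm (\<lambda>z. (comp_op \<phi> ^^ k) h z - f z) < e"
    using n 1 2 3 hardy2_add[OF g(1) s(1)] by blast
qed

text \<open>For |\<alpha>| = 1 this is the Cayley map of the disc onto the right half-plane with
  \<alpha> going to infinity and 0 to 1. At \<open>z = \<alpha>\<close> division by zero returns 0,
  whence the hypotheses \<open>\<alpha> \<noteq> z\<close> below.\<close>

definition cayley :: "complex \<Rightarrow> complex \<Rightarrow> complex" where
  "cayley \<alpha> z = (\<alpha> + z) / (\<alpha> - z)"

definition cayley_inv :: "complex \<Rightarrow> complex \<Rightarrow> complex" where
  "cayley_inv \<alpha> w = \<alpha> * (w - 1) / (w + 1)"

section \<open>The Cayley transform and its inverse\<close>

lemma not_mem_D: "cmod \<alpha> = 1 \<Longrightarrow> z \<in> D \<Longrightarrow> \<alpha> \<noteq> z"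
  by (auto simp: D_def)

lemma cayley_holomorphic: "cmod \<alpha> = 1 \<Longrightarrow> cayley \<alpha> holomorphic_on D"
  unfolding cayley_def[abs_def] by (intro holomorphic_intros) (auto dest: not_mem_D)

lemma cayley_0 [simp]: "cmod \<alpha> = 1 \<Longrightarrow> cayley \<alpha> 0 = 1"
  by (auto simp: cayley_def)

lemma cayley_plus_1: "\<alpha> \<noteq> z \<Longrightarrow> cayley \<alpha> z + 1 = 2 * \<alpha> / (\<alpha> - z)"
  by (simp add: cayley_def field_simps)

lemma Re_plus_1_neq_0: "0 < Re w \<Longrightarrow> w + 1 \<noteq> 0"
  by (metis add.inverse_unique add.commute less_numeral_extra(1) not_less_iff_gr_or_eq one_complex.simps(1) plus_complex.simps(1) trans_less_add1 zero_complex.simps(1) add_pos_pos)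

lemma cmod_Re_square_diff: "(cmod (w + 1))\<^sup>2 - (cmod (w - 1))\<^sup>2 = 4 * Re w"
  unfolding cmod_power2 by (simp add: power2_eq_square algebra_simps)

text \<open>The identity |w + 1|^2 - |w - 1|^2 = 4 Re w, divided by |w + 1|^2. It decides membership
  in the disc and later gives the rate at which a parabolic orbit approaches the circle.\<close>

lemma one_minus_cayley_inv:
  assumes "cmod \<alpha> = 1" "w + 1 \<noteq> 0"
  shows "1 - (cmod (cayley_inv \<alpha> w))\<^sup>2 = 4 * Re w / (cmod (w + 1))\<^sup>2"
proof -
  have nz: "(cmod (w + 1))\<^sup>2 \<noteq> 0" using assms(2) by simp
  have "(cmod (cayley_inv \<alpha> w))\<^sup>2 = (cmod (w - 1))\<^sup>2 / (cmod (w + 1))\<^sup>2"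
    using assms by (simp add: cayley_inv_def norm_mult norm_divide power_divide)
  then have "1 - (cmod (cayley_inv \<alpha> w))\<^sup>2 = ((cmod (w + 1))\<^sup>2 - (cmod (w - 1))\<^sup>2) / (cmod (w + 1))\<^sup>2"
    using nz by (simp add: diff_divide_distrib)
  then show ?thesis by (simp only: cmod_Re_square_diff)
qed

lemma cayley_inv_in_D:
  assumes "cmod \<alpha> = 1" "0 < Re w"
  shows "cayley_inv \<alpha> w \<in> D"
proof -
  have "0 < 1 - (cmod (cayley_inv \<alpha> w))\<^sup>2"
    unfolding one_minus_cayley_inv[OF assms(1) Re_plus_1_neq_0[OF assms(2)]] using assms Re_plus_1_neq_0[OF assms(2)] by simp
  then have "(cmod (cayley_inv \<alpha> w))\<^sup>2 < 1\<^sup>2" by simp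
  then show ?thesis unfolding D_def using power2_less_imp_less[of "cmod (cayley_inv \<alpha> w)" 1] by simp
qed

lemma cayley_cayley_inv:
  assumes "cmod \<alpha> = 1" "0 < Re w"
  shows "cayley \<alpha> (cayley_inv \<alpha> w) = w"
proof -
  have nz: "w + 1 \<noteq> 0" "\<alpha> \<noteq> 0" using assms Re_plus_1_neq_0 by auto
  have "cayley_inv \<alpha> w = \<alpha> * ((w - 1) / (w + 1))" by (simp add: cayley_inv_def)
  then have "\<alpha> + cayley_inv \<alpha> w = \<alpha> * (2 * w / (w + 1))" "\<alpha> - cayley_inv \<alpha> w = \<alpha> * (2 / (w + 1))"
    using nz by (auto simp: field_simps)
  then show ?thesis using nz by (simp add: cayley_def)
qed

lemma cayley_inv_cayley:
  assumes "cmod \<alpha> = 1" "\<alpha> \<noteq> z"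
  shows "cayley_inv \<alpha> (cayley \<alpha> z) = z"
proof -
  have "\<alpha> \<noteq> 0" using assms by auto
  have "cayley \<alpha> z - 1 = 2 * z / (\<alpha> - z)" using assms by (simp add: cayley_def field_simps)
  then show ?thesis using assms \<open>\<alpha> \<noteq> 0\<close> by (simp add: cayley_inv_def cayley_plus_1)
qed

lemma Re_cayley_pos:
  assumes \<alpha>: "cmod \<alpha> = 1" and z: "z \<in> D"
  shows "0 < Re (cayley \<alpha> z)"
proof -
  have "Re ((\<alpha> + z) * cnj (\<alpha> - z)) = (cmod \<alpha>)\<^sup>2 - (cmod z)\<^sup>2"
    unfolding cmod_power2 by (simp add: power2_eq_square algebra_simps)
  then have "0 < Re ((\<alpha> + z) * cnj (\<alpha> - z))"
    using assms by (simp add: D_def power_less_one_iff)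
  moreover have "cayley \<alpha> z = (\<alpha> + z) * cnj (\<alpha> - z) / complex_of_real ((cmod (\<alpha> - z))\<^sup>2)"
    unfolding cayley_def by (rule complex_div_cnj)
  then have "Re (cayley \<alpha> z) = Re ((\<alpha> + z) * cnj (\<alpha> - z)) / (cmod (\<alpha> - z))\<^sup>2"
    by (simp only: Re_divide_of_real)
  moreover have "0 < (cmod (\<alpha> - z))\<^sup>2" using not_mem_D[OF \<alpha> z] by simp
  ultimately show ?thesis by simp
qed

text \<open>Since Re Q = (Re X + |X|^2) / |1 + X|^2, the function Q is admissible in
  \<open>h2_dominated\<close>. The value Re Q(0) is weakened to |X(0)|: what matters is that the
  bound becomes small when X is scaled down.\<close>

lemma h2_norm_le_half_plane:
  assumes f: "f holomorphic_on D" and X: "X holomorphic_on D" "\<And>z. z \<in> D \<Longrightarrow> 0 < Re (X z)"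
    and le: "\<And>z. z \<in> D \<Longrightarrow> cmod (f z) \<le> K * (cmod (X z) / cmod (1 + X z))" and K: "0 \<le> K"
  shows "f \<in> hardy2" "h2_norm f \<le> K * sqrt (cmod (X 0))"
proof -
  have nz: "1 + X z \<noteq> 0" if "z \<in> D" for z using Re_plus_1_neq_0[OF X(2)[OF that]] by (simp add: add.commute)
  define Q where "Q z = X z / (1 + X z)" for z
  have Q: "Q holomorphic_on D" unfolding Q_def[abs_def] by (intro holomorphic_intros X nz)
  have ReQ: "(cmod (Q z))\<^sup>2 \<le> Re (Q z)" if z: "z \<in> D" for z
  proof -
    have "Q z = X z * cnj (1 + X z) / complex_of_real ((cmod (1 + X z))\<^sup>2)"
      unfolding Q_def by (rule complex_div_cnj)
    then have "Re (Q z) = Re (X z * cnj (1 + X z)) / (cmod (1 + X z))\<^sup>2"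
      by (simp only: Re_divide_of_real)
    moreover have "(cmod (Q z))\<^sup>2 = (cmod (X z))\<^sup>2 / (cmod (1 + X z))\<^sup>2"
      by (simp add: Q_def norm_divide power_divide)
    moreover have "Re (X z * cnj (1 + X z)) = Re (X z) + (cmod (X z))\<^sup>2"
      unfolding cmod_power2 by (simp add: power2_eq_square algebra_simps)
    ultimately show ?thesis using X(2)[OF z] by (simp add: divide_right_mono)
  qed
  have le': "cmod (f z) \<le> K * cmod (Q z)" if "z \<in> D" for z
    using le[OF that] by (simp add: Q_def norm_divide)
  note dom = h2_dominated[OF f Q ReQ le' K]
  show "f \<in> hardy2" using dom(1) by blast
  have z0: "0 \<in> D" by (simp add: D_def)
  have "1 \<le> cmod (1 + X 0)" using complex_Re_le_cmod[of "1 + X 0"] X(2)[OF z0] by simp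
  then have "cmod (Q 0) \<le> cmod (X 0)"
    unfolding Q_def norm_divide by (simp add: divide_le_eq mult_le_cancel_left1)
  then have "Re (Q 0) \<le> cmod (X 0)" using complex_Re_le_cmod[of "Q 0"] by linarith
  then have "K * sqrt (Re (Q 0)) \<le> K * sqrt (cmod (X 0))" using K by (intro mult_left_mono) auto
  then show "h2_norm f \<le> K * sqrt (cmod (X 0))" using dom(2) by fastforce
qed

text \<open>The companion for X scaled up: 1/X again has positive real part, and 1/(1 + X) is Q
  formed with 1/X.\<close>

lemma h2_norm_le_half_plane_inverse:
  assumes f: "f holomorphic_on D" and X: "X holomorphic_on D" "\<And>z. z \<in> D \<Longrightarrow> 0 < Re (X z)"
    and le: "\<And>z. z \<in> D \<Longrightarrow> cmod (f z) \<le> K / cmod (1 + X z)" and K: "0 \<le> K"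
  shows "f \<in> hardy2" "h2_norm f \<le> K / sqrt (cmod (X 0))"
proof -
  have nz: "X z \<noteq> 0" "1 + X z \<noteq> 0" if "z \<in> D" for z
    using X(2)[OF that] Re_plus_1_neq_0[OF X(2)[OF that]] by (auto simp: add.commute)
  have hol: "(\<lambda>z. inverse (X z)) holomorphic_on D" using nz X by (intro holomorphic_intros) auto
  have pos: "0 < Re (inverse (X z))" if "z \<in> D" for z
    using X(2)[OF that] nz[OF that] by (auto simp: Re_inverse sum_power2_gt_zero_iff complex_eq_iff intro!: divide_pos_pos)
  have le': "cmod (f z) \<le> K * (cmod (inverse (X z)) / cmod (1 + inverse (X z)))" if "z \<in> D" for z
  proof -
    have "inverse (X z) / (1 + inverse (X z)) = 1 / (1 + X z)"
      using nz[OF that] by (simp add: field_simps)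
    then have "cmod (inverse (X z)) / cmod (1 + inverse (X z)) = 1 / cmod (1 + X z)"
      by (metis norm_divide norm_one)
    then show ?thesis using le[OF that] by simp
  qed
  show "f \<in> hardy2" "h2_norm f \<le> K / sqrt (cmod (X 0))"
    using h2_norm_le_half_plane[OF f hol pos le' K]
    by (auto simp: norm_inverse real_sqrt_inverse divide_inverse)
qed

lemma polynomial_approximation_closed_disc:
  assumes f: "f holomorphic_on ball 0 R" and R: "1 < R" and e: "0 < e"
  obtains c :: "nat \<Rightarrow> complex" and N where "\<And>z. cmod z \<le> 1 \<Longrightarrow> cmod (f z - (\<Sum>i<N. c i * z ^ i)) < e"
proof -
  define c where "c n = (deriv ^^ n) f 0 / fact n" for n
  have sums: "(\<lambda>n. c n * z ^ n) sums f z" if "cmod z < R" for z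
    using holomorphic_power_series[OF f, of z] that by (simp add: c_def)
  \<comment> \<open>Convergence at one radius beyond 1 gives uniform convergence on the closed unit
    disc.\<close>
  define s where "s = (1 + R) / 2"
  have s: "1 < s" "s < R" using R by (auto simp: s_def)
  have "summable (\<lambda>n. c n * complex_of_real s ^ n)"
    using sums[of "complex_of_real s"] s by (auto simp: sums_iff)
  then have "ereal s \<le> conv_radius c" using conv_radius_geI[of c "complex_of_real s"] s by simp
  moreover have "ereal 1 < ereal s" using s by simp
  ultimately have "ereal 1 < conv_radius c" by (rule order_less_le_trans[rotated])
  from powser_uniform_limit[OF this, of 0] have
    "uniform_limit (cball 0 1) (\<lambda>n x. \<Sum>i<n. c i * x ^ i) (\<lambda>x. suminf (\<lambda>i. c i * x ^ i)) sequentially"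
    by simp
  then have "\<forall>\<^sub>F N in sequentially. \<forall>x\<in>cball 0 1. dist (\<Sum>i<N. c i * x ^ i) (suminf (\<lambda>i. c i * x ^ i)) < e"
    using e by (auto simp: uniform_limit_iff)
  then obtain N where N: "\<forall>x\<in>cball 0 1. dist (\<Sum>i<N. c i * x ^ i) (suminf (\<lambda>i. c i * x ^ i)) < e"
    unfolding eventually_sequentially by blast
  show ?thesis
  proof (rule that)
    fix z :: complex assume z: "cmod z \<le> 1"
    have "suminf (\<lambda>i. c i * z ^ i) = f z" using sums[of z] R z by (simp add: sums_iff)
    moreover have "dist (\<Sum>i<N. c i * z ^ i) (suminf (\<lambda>i. c i * z ^ i)) < e" using N z by simp
    ultimately show "cmod (f z - (\<Sum>i<N. c i * z ^ i)) < e"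
      by (simp add: dist_norm norm_minus_commute)
  qed
qed

text \<open>Polynomials in z need not extend boundedly to the half-plane Re v > 0 when its preimage contains
  the point at infinity; polynomials in the Cayley coordinate with a pole far enough to the left do.\<close>
lemma half_plane_functions_dense:
  assumes \<alpha>: "cmod \<alpha> = 1" and \<gamma>: "0 \<le> Re \<gamma>" and f: "f \<in> hardy2" and e: "0 < e"
  obtains G M where "G holomorphic_on {v. 0 < Re v}" "\<And>v. 0 < Re v \<Longrightarrow> cmod (G v) \<le> M" "0 \<le> M"
    "(\<lambda>z. G (cayley \<alpha> z + \<gamma>)) \<in> hardy2" "h2_norm (\<lambda>z. G (cayley \<alpha> z + \<gamma>) - f z) < e"
proof -
  obtain a :: "nat \<Rightarrow> complex" and N0 where q: "(\<lambda>z. \<Sum>i<N0. a i * z ^ i) \<in> hardy2"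
    and near: "h2_norm (\<lambda>z. f z - (\<Sum>i<N0. a i * z ^ i)) < e/2"
    using polynomials_dense_hardy2[OF f, of "e/2"] e by auto
  define q where "q z = (\<Sum>i<N0. a i * z ^ i)" for z
  \<comment> \<open>The polynomial variable will be y = (w - s)/(w + s) with w = v - \<gamma>; its
    pole in v is \<gamma> - s, which has real part -1.\<close>
  define s where "s = Re \<gamma> + 1"
  have s: "1 \<le> s" using \<gamma> by (simp add: s_def)
  \<comment> \<open>This expresses z through y: \<open>cayley_inv \<alpha>\<close> composed with the
    inverse of y = (w - s)/(w + s).\<close>
  define R where "R y = \<alpha> * (of_real (s - 1) + of_real (s + 1) * y) / (of_real (s + 1) + of_real (s - 1) * y)" for y :: complex
  \<comment> \<open>The pole of R, if s > 1, has modulus (s + 1)/(s - 1), beyond the radius (s +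
    1)/s > 1. Thus q o R extends past the closed disc |y| <= 1 and can be approximated there
    uniformly.\<close>
  have R_hol: "(\<lambda>y. q (R y)) holomorphic_on ball 0 ((s + 1) / s)"
    unfolding q_def R_def
  proof (intro holomorphic_intros)
    fix y :: complex assume y: "y \<in> ball 0 ((s + 1) / s)"
    show "complex_of_real (s + 1) + complex_of_real (s - 1) * y \<noteq> 0"
    proof
      assume "complex_of_real (s + 1) + complex_of_real (s - 1) * y = 0"
      then have "complex_of_real (s - 1) * y = - complex_of_real (s + 1)"
        by (metis add.commute eq_neg_iff_add_eq_0)
      then have "cmod (complex_of_real (s - 1) * y) = s + 1"
        using s by (metis norm_minus_cancel norm_of_real abs_of_nonneg add_nonneg_nonneg order_trans zero_le_one)
      then have "(s - 1) * cmod y = s + 1" using s by (simp only: norm_mult norm_of_real)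
      moreover have "(s - 1) * cmod y \<le> s * cmod y" by (simp add: mult_right_mono)
      moreover have "s * cmod y < s + 1" using y s by (simp add: field_simps)
      ultimately show False by linarith
    qed
  qed
  have "1 < (s + 1) / s" using s by simp
  from polynomial_approximation_closed_disc[OF R_hol this, of "e/2"] e
  obtain c :: "nat \<Rightarrow> complex" and N where P: "\<And>y. cmod y \<le> 1 \<Longrightarrow> cmod (q (R y) - (\<Sum>i<N. c i * y ^ i)) < e/2"
    by auto
  define G where "G v = (\<Sum>i<N. c i * ((v - \<gamma> - s) / (v - \<gamma> + s)) ^ i)" for v
  have Rden: "1 < Re (v - \<gamma> + s)" if "0 < Re v" for v using that by (simp add: s_def)
  then have den: "v - \<gamma> + s \<noteq> 0" if "0 < Re v" for v using that by (metis less_asym zero_complex.simps(1) zero_less_one)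
  have Ghol: "G holomorphic_on {v. 0 < Re v}"
    unfolding G_def using den by (intro holomorphic_intros) auto
  define M where "M = (\<Sum>i<N. cmod (c i) * (1 + 2 * s) ^ i)"
  \<comment> \<open>Off the image of the disc |y| may exceed 1, but the distance of v to the pole
    keeps it at most 1 + 2s.\<close>
  have Gbound: "cmod (G v) \<le> M" if v: "0 < Re v" for v
  proof -
    have "(v - \<gamma> - s) / (v - \<gamma> + s) = 1 - 2 * s / (v - \<gamma> + s)"
      using den[OF v] by (simp add: field_simps)
    then have "cmod ((v - \<gamma> - s) / (v - \<gamma> + s)) \<le> 1 + cmod (2 * s / (v - \<gamma> + s))"
      by (metis norm_one norm_triangle_ineq4)
    also have "cmod (2 * s / (v - \<gamma> + s)) \<le> 2 * s"
    proof -
      have "1 \<le> cmod (v - \<gamma> + s)" using Rden[OF v] complex_Re_le_cmod order_less_imp_le order_trans by blast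
      then show ?thesis using s by (simp add: norm_divide divide_le_eq mult_le_cancel_left1)
    qed
    finally have "cmod ((v - \<gamma> - s) / (v - \<gamma> + s)) \<le> 1 + 2 * s" by simp
    then show ?thesis unfolding G_def M_def
      by (intro sum_norm_le) (simp add: norm_mult norm_power mult_left_mono power_mono)
  qed
  have M: "0 \<le> M" using Gbound[of 1] norm_ge_zero[of "G 1"] by (smt (verit) one_complex.simps(1))
  have hol: "(\<lambda>z. G (cayley \<alpha> z + \<gamma>)) holomorphic_on D"
    by (rule holomorphic_on_compose_gen[of "\<lambda>z. cayley \<alpha> z + \<gamma>" D G "{v. 0 < Re v}", unfolded o_def])
       (use Re_cayley_pos[OF \<alpha>] \<gamma> in \<open>auto intro!: holomorphic_intros cayley_holomorphic \<alpha> Ghol add_pos_nonneg\<close>)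
  have mem: "(\<lambda>z. G (cayley \<alpha> z + \<gamma>)) \<in> hardy2"
    using bounded_hardy2(1)[OF hol, of M] Gbound Re_cayley_pos[OF \<alpha>] \<gamma> by (simp add: add_pos_nonneg)
  have close: "cmod (G (cayley \<alpha> z + \<gamma>) - q z) \<le> e/2" if z: "z \<in> D" for z
  proof -
    define w where "w = cayley \<alpha> z"
    define y where "y = (w - s) / (w + s)"
    have w: "0 < Re w" using Re_cayley_pos[OF \<alpha> z] by (simp add: w_def)
    have ws: "w + s \<noteq> 0" using w s by (auto simp: complex_eq_iff)
    have w1: "w + 1 \<noteq> 0" using Re_plus_1_neq_0[OF w] .
    have "(cmod (w - s))\<^sup>2 \<le> (cmod (w + s))\<^sup>2"
      unfolding cmod_power2 using w s by (simp add: power2_eq_square algebra_simps)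
    then have "cmod (w - s) \<le> cmod (w + s)" using power2_le_imp_le norm_ge_zero by blast
    then have y1: "cmod y \<le> 1" using ws by (simp add: y_def norm_divide)
    have sc: "complex_of_real s \<noteq> 0" using s by simp
    have "of_real (s - 1) + of_real (s + 1) * y = 2 * s * (w - 1) / (w + s)"
      using ws by (simp add: y_def field_simps)
    moreover have "of_real (s + 1) + of_real (s - 1) * y = 2 * s * (w + 1) / (w + s)"
      using ws by (simp add: y_def field_simps)
    ultimately have "R y = cayley_inv \<alpha> w"
      using sc ws w1 by (simp add: R_def cayley_inv_def)
    also have "\<dots> = z" using cayley_inv_cayley[OF \<alpha>] not_mem_D[OF \<alpha> z] by (simp add: w_def)
    finally have "R y = z" .
    moreover have "G (w + \<gamma>) = (\<Sum>i<N. c i * y ^ i)" by (simp add: G_def y_def)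
    ultimately show ?thesis using P[OF y1] by (simp add: w_def norm_minus_commute)
  qed
  have q2: "q \<in> hardy2" using q by (simp add: q_def[abs_def])
  have "h2_norm (\<lambda>z. G (cayley \<alpha> z + \<gamma>) - q z) \<le> e/2"
    using hardy2_diff[OF mem q2] close by (intro bounded_hardy2(2)) (auto simp: hardy2_def)
  moreover have "h2_norm (\<lambda>z. q z - f z) < e/2"
    using near h2_norm_diff_commute[of q f] by (simp add: q_def)
  ultimately have "h2_norm (\<lambda>z. G (cayley \<alpha> z + \<gamma>) - f z) < e"
    using h2_norm_diff_triangle[OF mem q2 f] by linarith
  with Ghol Gbound M mem that show ?thesis by blast
qed

section \<open>Maps of the half-plane without fixed points\<close>

lemma holomorphic_half_plane_compose:
  assumes "G holomorphic_on {v. 0 < Re v}" "X holomorphic_on D" "\<And>z. z \<in> D \<Longrightarrow> 0 < Re (X z)"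
  shows "(\<lambda>z. G (X z)) holomorphic_on D"
  by (rule holomorphic_on_compose_gen[of X D G "{v. 0 < Re v}", unfolded o_def]) (use assms in auto)

lemma cmod_1_plus_le:
  assumes "0 < Re v" "1 \<le> N"
  shows "cmod (1 + v) \<le> cmod (of_real N + v)" "cmod (1 + v) \<le> cmod (1 + of_real N * v)"
proof -
  have N: "1 \<le> N\<^sup>2" using assms by simp
  have "(cmod (1 + v))\<^sup>2 \<le> (cmod (of_real N + v))\<^sup>2"
    unfolding cmod_power2 using assms by (auto intro!: add_mono power_mono)
  then show "cmod (1 + v) \<le> cmod (of_real N + v)" by (rule power2_le_imp_le) simp
  have "(1 + Re v)\<^sup>2 \<le> (1 + N * Re v)\<^sup>2"
    using assms by (intro power_mono) (auto simp: mult_le_cancel_right1)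
  moreover have "(Im v)\<^sup>2 \<le> (N * Im v)\<^sup>2"
    using N by (simp add: power_mult_distrib mult_le_cancel_right1)
  ultimately have "(cmod (1 + v))\<^sup>2 \<le> (cmod (1 + of_real N * v))\<^sup>2"
    unfolding cmod_power2 by simp
  then show "cmod (1 + v) \<le> cmod (1 + of_real N * v)" by (rule power2_le_imp_le) simp
qed

lemma eventually_sqrt_small:
  assumes "0 < e" "0 < c"
  shows "\<forall>\<^sub>F x in at_top. K * sqrt (c / x) < e" "\<forall>\<^sub>F x in at_top. K / sqrt (x * c) < (e::real)"
proof -
  have "((\<lambda>x. K * sqrt (c / x)) \<longlongrightarrow> 0) at_top" using assms(2) by real_asymp
  then show "\<forall>\<^sub>F x in at_top. K * sqrt (c / x) < e" using order_tendstoD(2) assms(1) by blast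
  have "((\<lambda>x. K / sqrt (x * c)) \<longlongrightarrow> 0) at_top" using assms(2) by real_asymp
  then show "\<forall>\<^sub>F x in at_top. K / sqrt (x * c) < e" using order_tendstoD(2) assms(1) by blast
qed

text \<open>A bounded G is multiplied by two cutoffs, one vanishing at infinity and one at 0. Decay
  at infinity controls G where v is large, decay at 0 where v is small, as the two half-plane norm
  estimates require.\<close>

lemma decaying_functions_dense:
  assumes \<alpha>: "cmod \<alpha> = 1" and \<gamma>: "0 \<le> Re \<gamma>" and f: "f \<in> hardy2" and e: "0 < e"
  obtains G K where "G holomorphic_on {v. 0 < Re v}" "0 \<le> K"
    "\<And>v. 0 < Re v \<Longrightarrow> cmod (G v) \<le> K / cmod (1 + v)"
    "\<And>v. 0 < Re v \<Longrightarrow> cmod (G v) \<le> K * (cmod v / cmod (1 + v))"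
    "(\<lambda>z. G (cayley \<alpha> z + \<gamma>)) \<in> hardy2" "h2_norm (\<lambda>z. G (cayley \<alpha> z + \<gamma>) - f z) < e"
proof -
  obtain G M where G: "G holomorphic_on {v. 0 < Re v}" "\<And>v. 0 < Re v \<Longrightarrow> cmod (G v) \<le> M" "0 \<le> M"
    and G2: "(\<lambda>z. G (cayley \<alpha> z + \<gamma>)) \<in> hardy2" "h2_norm (\<lambda>z. G (cayley \<alpha> z + \<gamma>) - f z) < e/3"
    using half_plane_functions_dense[OF \<alpha> \<gamma> f, of "e/3"] e by auto
  define V where "V z = cayley \<alpha> z + \<gamma>" for z
  have V: "V holomorphic_on D" "0 < Re (V z)" if "z \<in> D" for z
    using that Re_cayley_pos[OF \<alpha>, of z] \<gamma> unfolding V_def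
    by (auto intro!: holomorphic_intros cayley_holomorphic \<alpha>)
  have D0: "0 \<in> D" by (simp add: D_def)
  then have c: "0 < cmod (V 0)" using V(2)[OF D0] by auto
  have "\<forall>\<^sub>F x in at_top. M * sqrt (cmod (V 0) / x) < e/3 \<and> M / sqrt (x * cmod (V 0)) < e/3 \<and> 1 \<le> x"
    using e c by (intro eventually_conj eventually_sqrt_small eventually_ge_at_top) auto
  then obtain N where N: "M * sqrt (cmod (V 0) / N) < e/3" "M / sqrt (N * cmod (V 0)) < e/3" "1 \<le> N"
    using eventually_happens trivial_limit_at_top_linorder by blast
  have nz: "of_real N + v \<noteq> 0" "1 + of_real N * v \<noteq> 0" "1 + v \<noteq> 0" if "0 < Re v" for v :: complex
  proof -
    have "0 < Re (1 + of_real N * v)" using that N by (simp add: add_pos_pos)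
    then show "1 + of_real N * v \<noteq> 0" by (metis less_irrefl zero_complex.simps(1))
    show "of_real N + v \<noteq> 0" "1 + v \<noteq> 0" using that N by (auto simp: complex_eq_iff)
  qed
  \<comment> \<open>Both cutoffs tend to 1 pointwise as N grows. Their defects 1 - A and 1 - B are
    X/(1 + X) for X = v/N and 1/(1 + X) for X = N v, which gives errors of order N^(-1/2).\<close>
  define A where "A v = of_real N / (of_real N + v)" for v :: complex
  define B where "B v = of_real N * v / (1 + of_real N * v)" for v :: complex
  have AB_hol: "A holomorphic_on {v. 0 < Re v}" "B holomorphic_on {v. 0 < Re v}"
    unfolding A_def[abs_def] B_def[abs_def] using nz by (auto intro!: holomorphic_intros)
  have A: "cmod (A v) \<le> N / cmod (1 + v)" if "0 < Re v" for v
    using cmod_1_plus_le(1)[OF that N(3)] N(3) nz[OF that]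
    by (auto simp: A_def norm_divide intro!: divide_left_mono mult_pos_pos)
  have B: "cmod (B v) \<le> N * (cmod v / cmod (1 + v))" if "0 < Re v" for v
    using cmod_1_plus_le(2)[OF that N(3)] N(3) nz[OF that]
    by (auto simp: B_def norm_divide norm_mult intro!: divide_left_mono mult_pos_pos)
  have A1: "cmod (A v) \<le> 1" if "0 < Re v" for v
  proof -
    have "N \<le> Re (of_real N + v)" using that by simp
    then have "N \<le> cmod (of_real N + v)" using complex_Re_le_cmod order_trans by blast
    then show ?thesis using N(3) nz[OF that] by (simp add: A_def norm_divide divide_le_eq_1)
  qed
  define H where "H v = G v * A v * B v" for v
  have bound: "cmod (H v) \<le> M * N\<^sup>2 * (cmod v / cmod (1 + v) / cmod (1 + v))" if v: "0 < Re v" for v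
  proof -
    have "cmod (H v) \<le> M * (N / cmod (1 + v)) * (N * (cmod v / cmod (1 + v)))"
      unfolding H_def norm_mult using G(2)[OF v] A[OF v] B[OF v] G(3) N(3)
      by (intro mult_mono) (auto intro!: mult_nonneg_nonneg)
    then show ?thesis by (simp add: power2_eq_square ac_simps)
  qed
  have le1: "cmod v / cmod (1 + v) \<le> 1" "1 \<le> cmod (1 + v)" if "0 < Re v" for v
  proof -
    have "(cmod v)\<^sup>2 \<le> (cmod (1 + v))\<^sup>2"
      unfolding cmod_power2 using that by (simp add: power2_eq_square algebra_simps)
    then have "cmod v \<le> cmod (1 + v)" by (rule power2_le_imp_le) simp
    then show "cmod v / cmod (1 + v) \<le> 1" by (simp add: divide_le_eq_1)
    show "1 \<le> cmod (1 + v)" using complex_Re_le_cmod[of "1 + v"] that by simp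
  qed
  show ?thesis
  proof (rule that)
    show "H holomorphic_on {v. 0 < Re v}"
      unfolding H_def[abs_def] by (intro holomorphic_intros G AB_hol)
    show K: "0 \<le> M * N\<^sup>2" using G N by simp
    show "cmod (H v) \<le> M * N\<^sup>2 / cmod (1 + v)" if "0 < Re v" for v
    proof -
      have "cmod v / cmod (1 + v) / cmod (1 + v) \<le> 1 / cmod (1 + v)"
        using le1[OF that] by (intro divide_right_mono) auto
      from mult_left_mono[OF this K] bound[OF that] show ?thesis by simp
    qed
    show "cmod (H v) \<le> M * N\<^sup>2 * (cmod v / cmod (1 + v))" if "0 < Re v" for v
    proof -
      have "cmod v / cmod (1 + v) / cmod (1 + v) \<le> cmod v / cmod (1 + v) / 1"
        using le1[OF that] by (intro divide_left_mono) auto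
      from mult_left_mono[OF this K] bound[OF that] show ?thesis by simp
    qed
    \<comment> \<open>The error G - G A B is split so that each part contains the defect of just one
      cutoff.\<close>
    define d1 where "d1 z = G (V z) * (1 - A (V z))" for z
    define d2 where "d2 z = G (V z) * A (V z) * (1 - B (V z))" for z
    have Vhol: "V holomorphic_on D" using V(1)[OF D0] .
    note comp = holomorphic_half_plane_compose[OF _ Vhol V(2)]
    have d_hol: "d1 holomorphic_on D" "d2 holomorphic_on D"
      unfolding d1_def[abs_def] d2_def[abs_def] by (intro holomorphic_intros comp G AB_hol; assumption)+
    have d1: "d1 \<in> hardy2" "h2_norm d1 \<le> M * sqrt (cmod (V 0 / of_real N))"
    proof -
      have hol: "(\<lambda>z. V z / of_real N) holomorphic_on D" using N by (intro holomorphic_intros Vhol) auto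
      have pos: "0 < Re (V z / of_real N)" if "z \<in> D" for z using V(2)[OF that] N by simp
      have "cmod (d1 z) \<le> M * (cmod (V z / of_real N) / cmod (1 + V z / of_real N))" if z: "z \<in> D" for z
      proof -
        have "1 - A (V z) = (V z / of_real N) / (1 + V z / of_real N)"
          using nz[OF V(2)[OF z]] N by (simp add: A_def field_simps)
        then have "cmod (d1 z) = cmod (G (V z)) * (cmod (V z / of_real N) / cmod (1 + V z / of_real N))"
          by (simp only: d1_def norm_mult norm_divide)
        then show ?thesis
          using mult_right_mono[OF G(2)[OF V(2)[OF z]],
              of "cmod (V z / of_real N) / cmod (1 + V z / of_real N)"] by simp
      qed
      from h2_norm_le_half_plane[OF d_hol(1) hol pos this G(3)]
      show "d1 \<in> hardy2" "h2_norm d1 \<le> M * sqrt (cmod (V 0 / of_real N))" by auto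
    qed
    have d2: "d2 \<in> hardy2" "h2_norm d2 \<le> M / sqrt (cmod (of_real N * V 0))"
    proof -
      have hol: "(\<lambda>z. of_real N * V z) holomorphic_on D" by (intro holomorphic_intros Vhol)
      have pos: "0 < Re (of_real N * V z)" if "z \<in> D" for z using V(2)[OF that] N by simp
      have "cmod (d2 z) \<le> M / cmod (1 + of_real N * V z)" if z: "z \<in> D" for z
      proof -
        have "1 - B (V z) = 1 / (1 + of_real N * V z)"
          using nz[OF V(2)[OF z]] N by (simp add: B_def field_simps)
        then have "cmod (d2 z) = cmod (G (V z)) * cmod (A (V z)) / cmod (1 + of_real N * V z)"
          by (simp add: d2_def norm_mult norm_divide)
        also have "\<dots> \<le> M * 1 / cmod (1 + of_real N * V z)"
          using G(2)[OF V(2)[OF z]] A1[OF V(2)[OF z]] G(3) by (intro divide_right_mono mult_mono) auto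
        finally show ?thesis by simp
      qed
      from h2_norm_le_half_plane_inverse[OF d_hol(2) hol pos this G(3)]
      show "d2 \<in> hardy2" "h2_norm d2 \<le> M / sqrt (cmod (of_real N * V 0))" by auto
    qed
    have "cmod (V 0 / of_real N) = cmod (V 0) / N" "cmod (of_real N * V 0) = N * cmod (V 0)"
      using N(3) by (simp_all add: norm_divide norm_mult)
    then have small: "h2_norm d1 < e/3" "h2_norm d2 < e/3"
      using order_le_less_trans[OF d1(2), of "e/3"] order_le_less_trans[OF d2(2), of "e/3"] N(1,2) by simp_all
    have eq: "H (V z) = G (V z) - (d1 z + d2 z)" for z by (simp add: H_def d1_def d2_def algebra_simps)
    have d12: "(\<lambda>z. d1 z + d2 z) \<in> hardy2" using hardy2_add d1 d2 by blast
    have "h2_norm (\<lambda>z. d1 z + d2 z) < 2 * e / 3"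
      using h2_norm_triangle[OF d1(1) d2(1)] small by simp
    have GV: "(\<lambda>z. G (V z)) \<in> hardy2" using G2 by (simp add: V_def)
    then show HV: "(\<lambda>z. H (cayley \<alpha> z + \<gamma>)) \<in> hardy2"
      using hardy2_diff[OF _ d12] by (simp add: eq V_def[symmetric])
    have "h2_norm (\<lambda>z. G (V z) - H (V z)) < 2 * e / 3" using \<open>h2_norm (\<lambda>z. d1 z + d2 z) < 2 * e / 3\<close> by (simp add: eq)
    then have "h2_norm (\<lambda>z. H (V z) - G (V z)) < 2 * e / 3" by (subst h2_norm_diff_commute)
    with G2(2) h2_norm_diff_triangle[of "\<lambda>z. H (V z)" "\<lambda>z. G (V z)" f] HV GV f
    show "h2_norm (\<lambda>z. H (cayley \<alpha> z + \<gamma>) - f z) < e" by (simp add: V_def)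
  qed
qed

text \<open>In the coordinate V = \<open>cayley \<alpha>\<close> + \<gamma> the n-th iterate is
  multiplication by \<kappa>^n. Forward images of G are small by decay at infinity, backward images
  by decay at 0.\<close>

lemma recurrent_hyperbolic:
  fixes \<kappa> :: real
  assumes \<alpha>: "cmod \<alpha> = 1" and \<gamma>: "0 \<le> Re \<gamma>" and \<kappa>: "1 < \<kappa>" and sub: "\<phi> ` D \<subseteq> D"
    and conj: "\<And>z. z \<in> D \<Longrightarrow> cayley \<alpha> (\<phi> z) + \<gamma> = of_real \<kappa> * (cayley \<alpha> z + \<gamma>)"
  shows "h2_recurrent (comp_op \<phi>)"
proof (rule recurrence_criterion[OF sub])
  fix f and e :: real assume f: "f \<in> hardy2" and e: "0 < e"
  define V where "V z = cayley \<alpha> z + \<gamma>" for z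
  have D0: "0 \<in> D" by (simp add: D_def)
  have V: "V holomorphic_on D" unfolding V_def by (intro holomorphic_intros cayley_holomorphic \<alpha>)
  have Vpos: "0 < Re (V z)" if "z \<in> D" for z
    using Re_cayley_pos[OF \<alpha> that] \<gamma> by (simp add: V_def)
  have c: "0 < cmod (V 0)" using Vpos[OF D0] by auto
  have pow: "V ((\<phi> ^^ n) z) = of_real (\<kappa> ^ n) * V z" if "z \<in> D" for n z
  proof (induction n)
    case (Suc n)
    then show ?case using conj[OF funpow_in_D[OF sub that], of n] by (simp add: V_def algebra_simps)
  qed simp
  obtain G K where G: "G holomorphic_on {v. 0 < Re v}" "0 \<le> K"
    and Gb: "\<And>v. 0 < Re v \<Longrightarrow> cmod (G v) \<le> K / cmod (1 + v)"
      "\<And>v. 0 < Re v \<Longrightarrow> cmod (G v) \<le> K * (cmod v / cmod (1 + v))"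
    and G2: "(\<lambda>z. G (V z)) \<in> hardy2" "h2_norm (\<lambda>z. G (V z) - f z) < e"
    using decaying_functions_dense[OF \<alpha> \<gamma> f e, folded V_def] by blast
  have "\<forall>\<^sub>F x in at_top. K * sqrt (cmod (V 0) / x) < e \<and> K / sqrt (x * cmod (V 0)) < e"
    using e c by (intro eventually_conj eventually_sqrt_small) auto
  then have "\<forall>\<^sub>F n in sequentially. K * sqrt (cmod (V 0) / \<kappa> ^ n) < e \<and> K / sqrt (\<kappa> ^ n * cmod (V 0)) < e"
    by (rule eventually_compose_filterlim) (use \<kappa> in real_asymp)
  then have "\<forall>\<^sub>F n in sequentially. (K * sqrt (cmod (V 0) / \<kappa> ^ n) < e \<and> K / sqrt (\<kappa> ^ n * cmod (V 0)) < e) \<and> n > 0"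
    by (rule eventually_conj[OF _ eventually_gt_at_top])
  then obtain n where n: "K * sqrt (cmod (V 0) / \<kappa> ^ n) < e" "K / sqrt (\<kappa> ^ n * cmod (V 0)) < e" "n > 0"
    using eventually_happens trivial_limit_sequentially by blast
  have ln: "0 < \<kappa> ^ n" using \<kappa> by simp
  define t where "t z = G (of_real (\<kappa> ^ n) * V z)" for z
  \<comment> \<open>Division by \<kappa>^n may leave the image of the disc under V but not the
    half-plane on which G is defined.\<close>
  define s where "s z = G (V z / of_real (\<kappa> ^ n))" for z
  have X1: "(\<lambda>z. of_real (\<kappa> ^ n) * V z) holomorphic_on D" by (intro holomorphic_intros V)
  have X2: "(\<lambda>z. V z / of_real (\<kappa> ^ n)) holomorphic_on D" using \<kappa> by (intro holomorphic_intros V) auto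
  have P1: "0 < Re (of_real (\<kappa> ^ n) * V z)" if "z \<in> D" for z
    unfolding times_complex.simps Re_complex_of_real Im_complex_of_real using Vpos[OF that] ln by simp
  have P2: "0 < Re (V z / of_real (\<kappa> ^ n))" if "z \<in> D" for z
    unfolding Re_divide_of_real using Vpos[OF that] ln by simp
  have t: "t \<in> hardy2" "h2_norm t \<le> K / sqrt (cmod (of_real (\<kappa> ^ n) * V 0))"
    using h2_norm_le_half_plane_inverse[OF _ X1 P1 _ G(2), of t]
      holomorphic_half_plane_compose[OF G(1) X1 P1] Gb(1)[OF P1] unfolding t_def[abs_def] by auto
  have s: "s \<in> hardy2" "h2_norm s \<le> K * sqrt (cmod (V 0 / of_real (\<kappa> ^ n)))"
    using h2_norm_le_half_plane[OF _ X2 P2 _ G(2), of s]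
      holomorphic_half_plane_compose[OF G(1) X2 P2] Gb(2)[OF P2] unfolding s_def[abs_def] by auto
  have "h2_norm t < e" "h2_norm s < e"
    using t(2) s(2) n ln \<kappa> by (simp_all add: norm_mult norm_divide norm_power)
  moreover have "t z = G (V ((\<phi> ^^ n) z))" "s ((\<phi> ^^ n) z) = G (V z)" if "z \<in> D" for z
    using pow[OF that, of n] \<kappa> by (simp_all add: t_def s_def)
  ultimately show "\<exists>g\<in>hardy2. h2_norm (\<lambda>z. g z - f z) < e \<and>
       (\<exists>n>0. \<exists>t\<in>hardy2. \<exists>s\<in>hardy2. h2_norm t < e \<and> h2_norm s < e \<and>
          (\<forall>z\<in>D. t z = g ((\<phi> ^^ n) z) \<and> s ((\<phi> ^^ n) z) = g z))"
    using G2 n(3) s(1) t(1) by (intro bexI[of _ "\<lambda>z. G (V z)"] conjI exI[of _ n] bexI[of _ t] bexI[of _ s]) auto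
qed

text \<open>Imaginary translations preserve the half-plane in both directions and both carry V(0)
  towards infinity, so decay at infinity handles the image and the preimage alike.\<close>

lemma recurrent_parabolic_automorphism:
  fixes \<tau> :: real
  assumes \<alpha>: "cmod \<alpha> = 1" and \<tau>: "\<tau> \<noteq> 0" and sub: "\<phi> ` D \<subseteq> D"
    and conj: "\<And>z. z \<in> D \<Longrightarrow> cayley \<alpha> (\<phi> z) = cayley \<alpha> z + \<i> * of_real \<tau>"
  shows "h2_recurrent (comp_op \<phi>)"
proof (rule recurrence_criterion[OF sub])
  fix f and e :: real assume f: "f \<in> hardy2" and e: "0 < e"
  define V where "V = cayley \<alpha>"
  have V: "V holomorphic_on D" unfolding V_def by (intro cayley_holomorphic \<alpha>)
  have Vpos: "0 < Re (V z)" if "z \<in> D" for z using Re_cayley_pos[OF \<alpha> that] by (simp add: V_def)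
  have pow: "V ((\<phi> ^^ n) z) = V z + \<i> * of_real (n * \<tau>)" if "z \<in> D" for n z
  proof (induction n)
    case (Suc n)
    then show ?case using conj[OF funpow_in_D[OF sub that], of n] by (simp add: V_def algebra_simps)
  qed simp
  have zero_le: "0 \<le> Re (0 :: complex)" by simp
  obtain G K where G: "G holomorphic_on {v. 0 < Re v}" "0 \<le> K"
    and Gb: "\<And>v. 0 < Re v \<Longrightarrow> cmod (G v) \<le> K / cmod (1 + v)"
    and G2: "(\<lambda>z. G (V z)) \<in> hardy2" "h2_norm (\<lambda>z. G (V z) - f z) < e"
    by (rule decaying_functions_dense[OF \<alpha> zero_le f e, unfolded add_0_right, folded V_def])
       (rule that; assumption)
  have "\<forall>\<^sub>F x in at_top. K / sqrt (x * \<bar>\<tau>\<bar>) < e"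
    using e \<tau> by (intro eventually_sqrt_small) auto
  then have "\<forall>\<^sub>F n in sequentially. K / sqrt (real n * \<bar>\<tau>\<bar>) < e"
    by (rule eventually_compose_filterlim) (rule filterlim_real_sequentially)
  then have "\<forall>\<^sub>F n in sequentially. K / sqrt (real n * \<bar>\<tau>\<bar>) < e \<and> n > 0"
    by (intro eventually_conj eventually_gt_at_top)
  then obtain n where n: "K / sqrt (real n * \<bar>\<tau>\<bar>) < e" "n > 0"
    using eventually_happens trivial_limit_sequentially by blast
  have small: "(\<lambda>z. G (V z + \<i> * of_real \<sigma>)) \<in> hardy2 \<and> h2_norm (\<lambda>z. G (V z + \<i> * of_real \<sigma>)) < e"
    if \<sigma>: "\<bar>\<sigma>\<bar> = real n * \<bar>\<tau>\<bar>" for \<sigma>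
  proof -
    have X: "(\<lambda>z. V z + \<i> * of_real \<sigma>) holomorphic_on D" by (intro holomorphic_intros V)
    have P: "0 < Re (V z + \<i> * of_real \<sigma>)" if "z \<in> D" for z using Vpos[OF that] by simp
    note * = h2_norm_le_half_plane_inverse[OF holomorphic_half_plane_compose[OF G(1) X P] X P Gb[OF P] G(2)]
    have pos: "0 < real n * \<bar>\<tau>\<bar>" using n \<tau> by simp
    \<comment> \<open>V(0) = 1 is real, so the imaginary part of the translated point is exactly
      \<sigma>.\<close>
    have "real n * \<bar>\<tau>\<bar> \<le> cmod (V 0 + \<i> * of_real \<sigma>)"
      using abs_Im_le_cmod[of "V 0 + \<i> * of_real \<sigma>"] \<alpha> \<sigma> by (simp add: V_def)
    then have "K / sqrt (cmod (V 0 + \<i> * of_real \<sigma>)) \<le> K / sqrt (real n * \<bar>\<tau>\<bar>)"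
      using pos G(2) by (intro divide_left_mono mult_pos_pos) auto
    then show ?thesis using * n by auto
  qed
  define t where "t z = G (V z + \<i> * of_real (real n * \<tau>))" for z
  define s where "s z = G (V z + \<i> * of_real (- (real n * \<tau>)))" for z
  have "t \<in> hardy2" "h2_norm t < e" "s \<in> hardy2" "h2_norm s < e"
    unfolding t_def[abs_def] s_def[abs_def] using small[of "real n * \<tau>"] small[of "- (real n * \<tau>)"]
    by (simp_all add: abs_mult)
  moreover have "t z = G (V ((\<phi> ^^ n) z))" "s ((\<phi> ^^ n) z) = G (V z)" if "z \<in> D" for z
    using pow[OF that, of n] by (simp_all add: t_def s_def)
  ultimately show "\<exists>g\<in>hardy2. h2_norm (\<lambda>z. g z - f z) < e \<and>
       (\<exists>n>0. \<exists>t\<in>hardy2. \<exists>s\<in>hardy2. h2_norm t < e \<and> h2_norm s < e \<and>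
          (\<forall>z\<in>D. t z = g ((\<phi> ^^ n) z) \<and> s ((\<phi> ^^ n) z) = g z))"
    using G2 n(2) by (intro bexI[of _ "\<lambda>z. G (V z)"] conjI exI[of _ n] bexI[of _ t] bexI[of _ s]) auto
qed

section \<open>Parabolic maps that are not automorphisms\<close>

lemma hardy2_diff_bound:
  assumes g: "g \<in> hardy2" and r: "r < 1" "cmod x \<le> r" "cmod y \<le> r"
  shows "cmod (g x - g y) \<le> h2_norm g * (2 / (1 - r)) powr (3/2) * cmod (x - y)"
proof (rule field_differentiable_bound[where S="cball 0 r"])
  fix z :: complex assume z: "z \<in> cball 0 r"
  then have "z \<in> D" "open D" using r by (auto simp: D_def)
  then show "(g has_field_derivative deriv g z) (at z within cball 0 r)"
    using hardy2_holomorphic[OF g] by (metis holomorphic_derivI has_field_derivative_at_within)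
  show "cmod (deriv g z) \<le> h2_norm g * (2 / (1 - r)) powr (3/2)"
    using h2_deriv_bound[OF g r(1), of z] z by simp
qed (use r in auto)

text \<open>The orbit of 0 moves so slowly, compared with its distance to the circle, that every function of
  the Hardy space becomes constant along it; the finitely many short return times are excluded by
  shrinking the neighbourhood of the identity function.\<close>
lemma not_recurrent_parabolic:
  assumes \<alpha>: "cmod \<alpha> = 1" and \<mu>: "0 < Re \<mu>" and sub: "\<phi> ` D \<subseteq> D"
    and conj: "\<And>z. z \<in> D \<Longrightarrow> cayley \<alpha> (\<phi> z) = cayley \<alpha> z + \<mu>"
  shows "\<not> h2_recurrent (comp_op \<phi>)"
proof
  assume rec: "h2_recurrent (comp_op \<phi>)"
  define x where "x k = (\<phi> ^^ k) 0" for k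
  define m where "m = Re \<mu>"
  \<comment> \<open>For k >= 1, |2 + k \<mu>| <= k B. Hence 1 - |x k|^2 = 4 (1 + k m) / |2 + k
    \<mu>|^2 >= 2 c / k with the \<open>c\<close> below, and |x k| <= 1 - c / k.\<close>
  define B where "B = 2 + cmod \<mu>"
  define c where "c = 2 * m / B\<^sup>2"
  have D0: "0 \<in> D" by (simp add: D_def)
  have xD: "x k \<in> D" for k unfolding x_def using funpow_in_D[OF sub D0] .
  have m: "0 < m" using \<mu> by (simp add: m_def)
  have B: "2 \<le> B" by (simp add: B_def)
  have c: "0 < c" using m B by (simp add: c_def)
  have W: "cayley \<alpha> (x k) = 1 + of_nat k * \<mu>" for k
  proof (induction k)
    case 0
    then show ?case using \<alpha> by (simp add: x_def)
  next
    case (Suc k)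
    then show ?case using conj[OF xD, of k] by (simp add: x_def algebra_simps)
  qed
  have x_eq: "x k = cayley_inv \<alpha> (1 + of_nat k * \<mu>)" for k
    using cayley_inv_cayley[OF \<alpha> not_mem_D[OF \<alpha> xD], of k] by (simp add: W)
  have x_nz: "x k \<noteq> 0" if "0 < k" for k
  proof
    assume "x k = 0"
    then have "1 + of_nat k * \<mu> = 1" using W[of k] \<alpha> by simp
    then have "\<mu> = 0" using that by simp
    then show False using \<mu> by simp
  qed
  have lower: "real k * m < cmod (2 + of_nat k * \<mu>)" for k
    using complex_Re_le_cmod[of "2 + of_nat k * \<mu>"] by (simp add: m_def)
  have nz: "2 + of_nat k * \<mu> \<noteq> 0" for k
    using lower[of k] m by (metis mult_nonneg_nonneg norm_zero not_less of_nat_0_le_iff order_less_imp_le)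
  have norm_x: "cmod (x k) \<le> 1 - c / real k" if k: "0 < k" for k
  proof -
    have "cmod (2 + of_nat k * \<mu>) \<le> 2 + real k * cmod \<mu>"
      using norm_triangle_ineq[of 2 "of_nat k * \<mu>"] by (simp add: norm_mult)
    also have "\<dots> \<le> real k * B" using k by (simp add: B_def algebra_simps)
    finally have up: "(cmod (2 + of_nat k * \<mu>))\<^sup>2 \<le> (real k * B)\<^sup>2" by (rule power_mono) simp
    have pos: "0 < (cmod (2 + of_nat k * \<mu>))\<^sup>2" using nz by simp
    have "2 * (c / real k) = 4 * (real k * m) / (real k * B)\<^sup>2"
      using k by (simp add: c_def power_mult_distrib power2_eq_square)
    also have "\<dots> \<le> 4 * (1 + real k * m) / (real k * B)\<^sup>2" by (intro divide_right_mono) auto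
    also have "\<dots> \<le> 4 * (1 + real k * m) / (cmod (2 + of_nat k * \<mu>))\<^sup>2"
      using up pos m k B by (intro divide_left_mono mult_pos_pos) auto
    also have "\<dots> = 1 - (cmod (x k))\<^sup>2"
      using one_minus_cayley_inv[OF \<alpha>, of "1 + of_nat k * \<mu>"] nz[of k]
      by (simp add: x_eq m_def add.commute add.left_commute)
    also have "\<dots> = (1 - cmod (x k)) * (1 + cmod (x k))" by (simp add: algebra_simps power2_eq_square)
    also have "\<dots> \<le> (1 - cmod (x k)) * 2" using xD[of k] by (intro mult_left_mono) (auto simp: D_def)
    finally show ?thesis by simp
  qed
  \<comment> \<open>As x_j = \<alpha> (1 - 2 / (2 + j \<mu>)), a difference of neighbours has two
    denominators of size at least k m and (k + 1) m.\<close>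
  have step: "cmod (x (Suc k) - x k) \<le> 2 * cmod \<mu> / (real k * (real k + 1) * m\<^sup>2)" if k: "0 < k" for k
  proof -
    have eq: "x j = \<alpha> * (1 - 2 / (2 + of_nat j * \<mu>))" for j
      using nz[of j] by (simp add: x_eq cayley_inv_def field_simps)
    have "x (Suc k) - x k = \<alpha> * (2 / (2 + of_nat k * \<mu>) - 2 / (2 + of_nat (Suc k) * \<mu>))"
      unfolding eq by (simp only: algebra_simps)
    also have "2 / (2 + of_nat k * \<mu>) - 2 / (2 + of_nat (Suc k) * \<mu>) =
        2 * \<mu> / ((2 + of_nat k * \<mu>) * (2 + of_nat (Suc k) * \<mu>))"
      using diff_frac_eq[OF nz[of k] nz[of "Suc k"], of 2 2] by (simp add: algebra_simps)
    finally have "cmod (x (Suc k) - x k) =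
        2 * cmod \<mu> / (cmod (2 + of_nat k * \<mu>) * cmod (2 + of_nat (Suc k) * \<mu>))"
      by (simp only: norm_mult norm_divide \<alpha> norm_numeral mult_1)
    also have "\<dots> \<le> 2 * cmod \<mu> / ((real k * m) * (real (Suc k) * m))"
      using lower[of k] lower[of "Suc k"] m k nz[of k] nz[of "Suc k"]
      by (intro divide_left_mono mult_mono mult_pos_pos) auto
    finally show ?thesis by (simp add: power2_eq_square algebra_simps)
  qed
  \<comment> \<open>The summand 1 accounts for the identity function, the power for the deviation f
    - id, whose derivative is bounded on a disc of radius 1 - c/(k + 1). In total S is of order
    k^(-1/2).\<close>
  define S where "S k = (1 + (2 * (real k + 1) / c) powr (3/2)) * (2 * cmod \<mu> / (real k * (real k + 1) * m\<^sup>2))" for k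
  have "(\<lambda>k. S k) \<longlonglongrightarrow> 0" unfolding S_def using m c by real_asymp
  moreover have p: "0 < cmod (x 1)" using x_nz[of 1] by simp
  ultimately have "\<forall>\<^sub>F k in sequentially. S k < cmod (x 1) / 2"
    by (intro order_tendstoD(2)) auto
  then obtain k0 where k0: "\<And>k. k0 \<le> k \<Longrightarrow> S k < cmod (x 1) / 2"
    unfolding eventually_sequentially by blast
  have near: "cmod (f (x (Suc k)) - f (x k)) \<le> S k"
    if f: "f \<in> hardy2" "h2_norm (\<lambda>z. f z - z) \<le> 1" and k: "0 < k" for f k
  proof -
    \<comment> \<open>The radius belonging to k + 1 covers both orbit points.\<close>
    define r where "r = 1 - c / (real k + 1)"
    have r: "r < 1" "2 / (1 - r) = 2 * (real k + 1) / c" using c by (simp_all add: r_def)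
    have mono: "c / (real k + 1) \<le> c / real k" using c k by (intro divide_left_mono) auto
    have rx: "cmod (x (Suc k)) \<le> r" "cmod (x k) \<le> r"
      using norm_x[OF k] norm_x[of "Suc k"] mono by (simp_all add: r_def add.commute)
    define g where "g z = f z - z" for z
    have g: "g \<in> hardy2" unfolding g_def[abs_def] using hardy2_diff[OF f(1) identity_hardy2] .
    have "cmod (g (x (Suc k)) - g (x k)) \<le> h2_norm g * (2 / (1 - r)) powr (3/2) * cmod (x (Suc k) - x k)"
      using hardy2_diff_bound[OF g r(1) rx] .
    also have "\<dots> \<le> 1 * (2 / (1 - r)) powr (3/2) * cmod (x (Suc k) - x k)"
      using f(2) by (intro mult_right_mono) (auto simp: g_def[abs_def])
    finally have "cmod (g (x (Suc k)) - g (x k)) \<le> (2 * (real k + 1) / c) powr (3/2) * cmod (x (Suc k) - x k)"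
      by (simp add: r(2))
    moreover have "f (x (Suc k)) - f (x k) = (x (Suc k) - x k) + (g (x (Suc k)) - g (x k))"
      by (simp add: g_def)
    ultimately have "cmod (f (x (Suc k)) - f (x k)) \<le> (1 + (2 * (real k + 1) / c) powr (3/2)) * cmod (x (Suc k) - x k)"
      using norm_triangle_ineq[of "x (Suc k) - x k" "g (x (Suc k)) - g (x k)"] by (simp add: distrib_right)
    also have "\<dots> \<le> S k" unfolding S_def by (intro mult_left_mono step k) auto
    finally show ?thesis .
  qed
  define w where "w z = sqrt (1 - cmod z)" for z :: complex
  have w: "0 < w z" "w z \<le> 1" if "z \<in> D" for z using that by (auto simp: w_def D_def)
  have ev: "\<forall>\<^sub>F e in at_right 0. e < b" if "0 < b" for b :: real
    using eventually_at_right_real[OF that] by eventually_elim auto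
  \<comment> \<open>The bound through \<open>x 1\<close> is for return times k >= k0. The finitely
    many others are for k < k0, where f(x_k) would have to be close both to 0 and to the non-zero
    x_k.\<close>
  have "\<forall>\<^sub>F e in at_right (0::real). 0 < e \<and> e < 1 \<and> e < cmod (x 1) * w (x 1) / 4 \<and>
     (\<forall>k\<in>{0<..<k0}. e < cmod (x k) / (1 + 1 / w (x k)))"
  proof (intro eventually_conj eventually_ball_finite ballI ev)
    show "\<forall>\<^sub>F e in at_right (0::real). 0 < e" by (simp add: eventually_at_right_less)
    show "0 < cmod (x k) / (1 + 1 / w (x k))" if "k \<in> {0<..<k0}" for k
      using x_nz[of k] w[OF xD, of k] that by (auto intro!: divide_pos_pos add_pos_pos)
  qed (use p w[OF xD] in auto)
  then obtain e where e: "0 < e" "e < 1" "e < cmod (x 1) * w (x 1) / 4"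
    and ek: "\<And>k. k \<in> {0<..<k0} \<Longrightarrow> e < cmod (x k) / (1 + 1 / w (x k))"
    using eventually_happens trivial_limit_at_right_real by blast
  let ?U = "{g \<in> hardy2. h2_norm (\<lambda>z. g z - z) < e}"
  have "h2_norm (\<lambda>z. z - z) \<le> 0" using bounded_hardy2(2)[of "\<lambda>z. z - z" 0] by simp
  then have "(\<lambda>z. z) \<in> ?U" using identity_hardy2 e by simp
  then obtain k f where k: "0 < k" and f: "f \<in> ?U" "(comp_op \<phi> ^^ k) f \<in> ?U"
    using rec h2_open_ball[OF identity_hardy2, of e] unfolding h2_recurrent_def by blast
  define h where "h z = (comp_op \<phi> ^^ k) f z - z" for z
  have h: "h \<in> hardy2" "h2_norm h < e"
    using f hardy2_diff[OF _ identity_hardy2] unfolding h_def[abs_def] by auto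
  have h_le: "cmod (h z) \<le> e / w z" if "z \<in> D" for z
    using h2_growth[OF h(1) that] h(2) w[OF that] divide_right_mono[of "h2_norm h" e "w z"]
    unfolding w_def by linarith
  \<comment> \<open>The identity has the values 0 at 0 and x_1 at x_1; the iterate carries these
    points to x_k and x_(k+1).\<close>
  have h0: "cmod (f (x k)) \<le> e"
    using h_le[OF D0] by (simp add: h_def comp_op_power x_def w_def)
  have "(\<phi> ^^ k) (x 1) = x (Suc k)" by (simp add: x_def funpow_swap1)
  then have h1: "cmod (f (x (Suc k)) - x 1) \<le> e / w (x 1)"
    using h_le[OF xD, of 1] by (simp add: h_def comp_op_power)
  show False
  proof (cases "k < k0")
    case True
    have g: "(\<lambda>z. f z - z) \<in> hardy2" using hardy2_diff[OF _ identity_hardy2] f by auto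
    have "cmod (f (x k) - x k) \<le> e / w (x k)"
      using h2_growth[OF g xD, of k] f w[OF xD, of k] divide_right_mono[of "h2_norm (\<lambda>z. f z - z)" e "w (x k)"]
      unfolding w_def by auto
    then have "cmod (x k) \<le> e + e / w (x k)"
      using h0 norm_triangle_ineq4[of "f (x k)" "f (x k) - x k"] by simp
    also have "\<dots> = e * (1 + 1 / w (x k))" by (simp add: algebra_simps)
    finally have "cmod (x k) / (1 + 1 / w (x k)) \<le> e"
      using w[OF xD, of k] by (subst pos_divide_le_eq) (auto intro: add_pos_pos)
    then show False using ek[of k] True k by simp
  next
    case False
    have "cmod (x 1) \<le> cmod (f (x (Suc k)) - x 1) + cmod (f (x (Suc k)) - f (x k)) + cmod (f (x k))"
      by (smt (verit) norm_triangle_ineq norm_minus_commute norm_triangle_sub)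
    also have "\<dots> \<le> e / w (x 1) + S k + e"
      using h0 h1 near[OF _ _ k, of f] f e by (intro add_mono) auto
    also have "\<dots> < cmod (x 1) / 4 + cmod (x 1) / 2 + cmod (x 1) / 4"
    proof (intro add_strict_mono)
      show "e / w (x 1) < cmod (x 1) / 4" using e w[OF xD, of 1] by (simp add: field_simps)
      show "S k < cmod (x 1) / 2" using k0 False by simp
      have "cmod (x 1) * w (x 1) \<le> cmod (x 1)" using w[OF xD, of 1] by (simp add: mult_left_le)
      then show "e < cmod (x 1) / 4" using e by simp
    qed
    finally show False by simp
  qed
qed

section \<open>Linear fractional self-maps of the disc\<close>

lemma lf_selfmapD:
  assumes "lf_selfmap a b c d"
  shows "a * d - b * c \<noteq> 0" "lft a b c d ` D \<subseteq> D" "lft a b c d holomorphic_on D" "inj_on (lft a b c d) D"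
proof -
  show \<Delta>: "a * d - b * c \<noteq> 0" and "lft a b c d ` D \<subseteq> D" using assms by (auto simp: lf_selfmap_def)
  have den: "\<And>z. z \<in> D \<Longrightarrow> c * z + d \<noteq> 0" using assms by (auto simp: lf_selfmap_def)
  then show "lft a b c d holomorphic_on D" unfolding lft_def[abs_def] by (intro holomorphic_intros)
  show "inj_on (lft a b c d) D"
  proof (rule inj_onI)
    fix x y assume xy: "x \<in> D" "y \<in> D" and "lft a b c d x = lft a b c d y"
    then have "(a * x + b) * (c * y + d) = (a * y + b) * (c * x + d)"
      using den by (simp add: lft_def frac_eq_eq)
    then have "(a * d - b * c) * (x - y) = 0" by (simp add: algebra_simps)
    then show "x = y" using \<Delta> by simp
  qed
qed

text \<open>Comparing numerator and denominator, rather than the quotient with 1, survives the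
  radial limit. A zero of the denominator on the circle would then be a common zero, against the
  non-zero determinant.\<close>

lemma lf_selfmap_closed:
  assumes "lf_selfmap a b c d" "cmod z \<le> 1"
  shows "cmod (a * z + b) \<le> cmod (c * z + d)" "c * z + d \<noteq> 0"
proof -
  show le: "cmod (a * z + b) \<le> cmod (c * z + d)"
  proof (rule tendsto_le)
    have "((\<lambda>r. cmod (c * (complex_of_real r * z) + d)) \<longlongrightarrow> cmod (c * (complex_of_real 1 * z) + d)) (at_left 1)"
      by (intro tendsto_intros)
    then show "((\<lambda>r. cmod (c * (complex_of_real r * z) + d)) \<longlongrightarrow> cmod (c * z + d)) (at_left 1)" by simp
    have "((\<lambda>r. cmod (a * (complex_of_real r * z) + b)) \<longlongrightarrow> cmod (a * (complex_of_real 1 * z) + b)) (at_left 1)"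
      by (intro tendsto_intros)
    then show "((\<lambda>r. cmod (a * (complex_of_real r * z) + b)) \<longlongrightarrow> cmod (a * z + b)) (at_left 1)" by simp
    show "\<forall>\<^sub>F r in at_left 1. cmod (a * (complex_of_real r * z) + b) \<le> cmod (c * (complex_of_real r * z) + d)"
      using eventually_at_left_real[OF zero_less_one[where 'a=real]]
    proof eventually_elim
      case (elim r)
      have r: "0 < r" "r < 1" using elim by auto
      have "r * cmod z \<le> r * 1" using elim assms(2) by (intro mult_left_mono) auto
      then have "r * cmod z < 1" using r by linarith
      then have "complex_of_real r * z \<in> D" using elim by (simp add: D_def norm_mult)
      then have "c * (complex_of_real r * z) + d \<noteq> 0" "cmod (lft a b c d (complex_of_real r * z)) < 1"
        using assms(1) by (auto simp: lf_selfmap_def D_def)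
      then show ?case by (simp add: lft_def norm_divide divide_less_eq_1)
    qed
  qed simp
  show "c * z + d \<noteq> 0"
  proof
    assume 0: "c * z + d = 0"
    then have "a * z + b = 0" using le by simp
    then have "b = - a * z" "d = - c * z" using 0 by (simp_all add: eq_neg_iff_add_eq_0 add.commute)
    then have "a * d - b * c = 0" by simp
    then show False using lf_selfmapD(1)[OF assms(1)] by simp
  qed
qed

section \<open>Normal form at a boundary fixed point\<close>

lemma boundary_fixed_point:
  assumes lf: "lf_selfmap a b c d" and no: "\<And>z. z \<in> D \<Longrightarrow> lft a b c d z \<noteq> z"
  obtains \<alpha> where "cmod \<alpha> = 1" "lft a b c d \<alpha> = \<alpha>"
proof -
  have "continuous_on (cball 0 1) (lft a b c d)"
    unfolding lft_def[abs_def] using lf_selfmap_closed(2)[OF lf] by (intro continuous_intros) auto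
  moreover have "lft a b c d \<in> cball 0 1 \<rightarrow> cball 0 1"
    using lf_selfmap_closed[OF lf] by (auto simp: lft_def norm_divide divide_le_eq_1)
  ultimately obtain x where x: "x \<in> cball 0 1" "lft a b c d x = x"
    using brouwer_ball[of 1 "0 :: complex" "lft a b c d"] by auto
  then have "x \<notin> D" using no by blast
  with x have "cmod x = 1" by (simp add: D_def)
  with x that show ?thesis by blast
qed

text \<open>Cancelling z - \<alpha> turns this into the criterion for a second finite fixed point z:
  (c z + d)(c \<alpha> + d) = a d - b c. It also shows that the derivative at \<alpha> is (a d - b
  c) / (c \<alpha> + d)^2.\<close>

lemma lft_diff_fixed:
  assumes "lft a b c d \<alpha> = \<alpha>" "c * \<alpha> + d \<noteq> 0" "c * z + d \<noteq> 0"
  shows "lft a b c d z - \<alpha> = (a * d - b * c) * (z - \<alpha>) / ((c * z + d) * (c * \<alpha> + d))"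
proof -
  have "lft a b c d z - lft a b c d \<alpha> = (a * d - b * c) * (z - \<alpha>) / ((c * z + d) * (c * \<alpha> + d))"
    unfolding lft_def using assms(2,3) by (simp add: diff_frac_eq) (simp add: algebra_simps)
  then show ?thesis by (simp add: assms(1))
qed

text \<open>The coordinate sends the fixed point \<alpha> to infinity, so the map becomes affine;
  its slope is the reciprocal of the derivative at \<alpha>. The computation uses that
  \<open>cayley \<alpha> z + 1\<close> is a multiple of 1/(\<alpha> - z).\<close>

lemma cayley_lft:
  assumes fp: "lft a b c d \<alpha> = \<alpha>" and nz: "c * \<alpha> + d \<noteq> 0" "a * d - b * c \<noteq> 0" and z: "c * z + d \<noteq> 0" "\<alpha> \<noteq> z"
  defines "\<Delta> \<equiv> a * d - b * c" and "\<delta> \<equiv> c * \<alpha> + d"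
  shows "cayley \<alpha> (lft a b c d z) = \<delta>\<^sup>2 / \<Delta> * cayley \<alpha> z + (\<delta>\<^sup>2 / \<Delta> - 1 - 2 * \<alpha> * c * \<delta> / \<Delta>)"
    and "\<alpha> \<noteq> lft a b c d z"
proof -
  note nz' = nz[folded \<Delta>_def \<delta>_def]
  have eq: "\<alpha> - lft a b c d z = \<Delta> * (\<alpha> - z) / ((c * z + d) * \<delta>)"
    using lft_diff_fixed[OF fp nz(1) z(1)] unfolding \<Delta>_def \<delta>_def
    by (metis minus_diff_eq minus_divide_left mult_minus_right)
  then show ne: "\<alpha> \<noteq> lft a b c d z" using nz' z by auto
  have \<delta>: "c * z + d = \<delta> - c * (\<alpha> - z)" by (simp add: \<delta>_def algebra_simps)
  have "cayley \<alpha> (lft a b c d z) + 1 = 2 * \<alpha> * ((c * z + d) * \<delta>) / (\<Delta> * (\<alpha> - z))"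
    unfolding cayley_plus_1[OF ne] eq by simp
  also have "\<dots> = 2 * \<alpha> * (\<delta>\<^sup>2 - c * \<delta> * (\<alpha> - z)) / (\<Delta> * (\<alpha> - z))"
    unfolding \<delta> by (simp add: power2_eq_square algebra_simps)
  also have "\<dots> = \<delta>\<^sup>2 / \<Delta> * (2 * \<alpha> / (\<alpha> - z)) - 2 * \<alpha> * c * \<delta> / \<Delta>"
    using nz' z by (simp add: field_simps)
  also have "2 * \<alpha> / (\<alpha> - z) = cayley \<alpha> z + 1" using cayley_plus_1[OF z(2)] by simp
  finally show "cayley \<alpha> (lft a b c d z) = \<delta>\<^sup>2 / \<Delta> * cayley \<alpha> z + (\<delta>\<^sup>2 / \<Delta> - 1 - 2 * \<alpha> * c * \<delta> / \<Delta>)"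
    by (simp add: algebra_simps add_divide_distrib)
qed

text \<open>Along the ray t (1 + \<i> y) with t large, the real part is governed by Re \<kappa> - y
  Im \<kappa>, which must be nonnegative for every real y. Small positive w then give the sign of Re
  \<mu>.\<close>

lemma half_plane_affine:
  assumes "\<And>w. 0 < Re w \<Longrightarrow> 0 < Re (\<kappa> * w + \<mu>)"
  shows "Im \<kappa> = 0" "0 \<le> Re \<kappa>" "0 \<le> Re \<mu>"
proof -
  have ge: "0 \<le> Re \<kappa> - y * Im \<kappa>" for y
  proof (rule ccontr)
    assume neg: "\<not> 0 \<le> Re \<kappa> - y * Im \<kappa>"
    define t where "t = (\<bar>Re \<mu>\<bar> + 1) / (y * Im \<kappa> - Re \<kappa>)"
    have t: "0 < t" "t * (Re \<kappa> - y * Im \<kappa>) = - (\<bar>Re \<mu>\<bar> + 1)"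
      using neg by (auto simp: t_def field_simps)
    have "0 < Re (\<kappa> * Complex t (t * y) + \<mu>)" using t by (intro assms) simp
    then have "0 < t * (Re \<kappa> - y * Im \<kappa>) + Re \<mu>" by (simp add: algebra_simps)
    then show False unfolding t(2) by simp
  qed
  show "0 \<le> Re \<kappa>" using ge[of 0] by simp
  show "Im \<kappa> = 0"
  proof (rule ccontr)
    assume "Im \<kappa> \<noteq> 0"
    \<comment> \<open>For this y the expression Re \<kappa> - y Im \<kappa> equals -1.\<close>
    then show False using ge[of "(Re \<kappa> + 1) / Im \<kappa>"] by simp
  qed
  show "0 \<le> Re \<mu>"
  proof (rule ccontr)
    assume neg: "\<not> 0 \<le> Re \<mu>"
    define t where "t = - Re \<mu> / (Re \<kappa> + 1)"
    have t: "0 < t" using neg \<open>0 \<le> Re \<kappa>\<close> by (auto simp: t_def divide_neg_pos)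
    have "0 < Re (\<kappa> * of_real t + \<mu>)" using t by (intro assms) simp
    then have "0 < Re \<kappa> * t + Re \<mu>" by simp
    also have "\<dots> < (Re \<kappa> + 1) * t + Re \<mu>" using t by (simp add: algebra_simps)
    also have "(Re \<kappa> + 1) * t = - Re \<mu>" using \<open>0 \<le> Re \<kappa>\<close> by (simp add: t_def)
    finally show False by simp
  qed
qed

text \<open>The affine formula is kept for all z with non-zero denominator other than \<alpha>,
  since it has to be evaluated at a second fixed point on the circle. The clause on c = 0 later
  excludes a fixed point at infinity in the parabolic case.\<close>

lemma half_plane_model_at:
  assumes lf: "lf_selfmap a b c d" and \<alpha>: "cmod \<alpha> = 1" "lft a b c d \<alpha> = \<alpha>"
  obtains \<kappa> \<mu> where "0 < \<kappa>" "0 \<le> Re \<mu>"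
    "of_real \<kappa> * (a * d - b * c) = (c * \<alpha> + d)\<^sup>2"
    "c = 0 \<Longrightarrow> \<mu> = of_real \<kappa> - 1"
    "\<And>z. c * z + d \<noteq> 0 \<Longrightarrow> \<alpha> \<noteq> z \<Longrightarrow>
       \<alpha> \<noteq> lft a b c d z \<and> cayley \<alpha> (lft a b c d z) = of_real \<kappa> * cayley \<alpha> z + \<mu>"
proof -
  define \<Delta> where "\<Delta> = a * d - b * c"
  define \<delta> where "\<delta> = c * \<alpha> + d"
  define k where "k = \<delta>\<^sup>2 / \<Delta>"
  define \<mu> where "\<mu> = k - 1 - 2 * \<alpha> * c * \<delta> / \<Delta>"
  have nz: "c * \<alpha> + d \<noteq> 0" "a * d - b * c \<noteq> 0"
    using lf_selfmap_closed(2)[OF lf, of \<alpha>] lf_selfmapD(1)[OF lf] \<alpha> by auto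
  note W = cayley_lft[OF \<alpha>(2) nz, folded \<Delta>_def \<delta>_def, folded k_def, folded \<mu>_def]
  have pos: "0 < Re (k * w + \<mu>)" if "0 < Re w" for w
  proof -
    have z: "cayley_inv \<alpha> w \<in> D" using cayley_inv_in_D[OF \<alpha>(1) that] .
    then have "lft a b c d (cayley_inv \<alpha> w) \<in> D" "c * cayley_inv \<alpha> w + d \<noteq> 0"
      using lf by (auto simp: lf_selfmap_def)
    then show ?thesis
      using Re_cayley_pos[OF \<alpha>(1)] W(1)[OF _ not_mem_D[OF \<alpha>(1) z]] cayley_cayley_inv[OF \<alpha>(1) that] by metis
  qed
  note hp = half_plane_affine[of k \<mu>, OF pos]
  have "k = of_real (Re k)" using hp(1) by (simp add: complex_eq_iff)
  moreover have "k \<noteq> 0" using nz by (simp add: k_def \<delta>_def \<Delta>_def)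
  ultimately have "0 < Re k" using hp(2) by (metis of_real_0 order_le_less)
  show ?thesis
  proof (rule that[of "Re k" \<mu>])
    show "of_real (Re k) * (a * d - b * c) = (c * \<alpha> + d)\<^sup>2"
      using nz by (simp add: \<open>k = of_real (Re k)\<close>[symmetric]) (simp add: k_def \<delta>_def \<Delta>_def)
    show "c = 0 \<Longrightarrow> \<mu> = of_real (Re k) - 1"
      by (simp add: \<open>k = of_real (Re k)\<close>[symmetric]) (simp add: \<mu>_def)
    show "\<alpha> \<noteq> lft a b c d z \<and> cayley \<alpha> (lft a b c d z) = of_real (Re k) * cayley \<alpha> z + \<mu>"
      if "c * z + d \<noteq> 0" "\<alpha> \<noteq> z" for z
      using W[OF that] \<open>k = of_real (Re k)\<close> by simp
  qed (use \<open>0 < Re k\<close> hp in auto)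
qed

text \<open>If the boundary fixed point found by Brouwer's theorem is repelling (multiplier below 1), the other
  fixed point of the half-plane map also lies on the boundary and has the inverse multiplier.\<close>
lemma half_plane_model:
  assumes lf: "lf_selfmap a b c d" and no: "\<And>z. z \<in> D \<Longrightarrow> lft a b c d z \<noteq> z"
  obtains \<alpha> \<kappa> \<mu> where "cmod \<alpha> = 1" "lft a b c d \<alpha> = \<alpha>" "1 \<le> \<kappa>" "0 \<le> Re \<mu>"
    "of_real \<kappa> * (a * d - b * c) = (c * \<alpha> + d)\<^sup>2"
    "c = 0 \<Longrightarrow> \<mu> = of_real \<kappa> - 1" "\<kappa> = 1 \<Longrightarrow> \<mu> \<noteq> 0"
    "\<And>z. z \<in> D \<Longrightarrow> cayley \<alpha> (lft a b c d z) = of_real \<kappa> * cayley \<alpha> z + \<mu>"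
proof -
  obtain \<alpha> where \<alpha>: "cmod \<alpha> = 1" "lft a b c d \<alpha> = \<alpha>" using boundary_fixed_point[OF lf no] by blast
  note result = that
  \<comment> \<open>Any boundary fixed point with \<kappa> >= 1 suffices; the determinant equation
    identifies its \<kappa> with the slope of the model.\<close>
  have good: thesis if \<alpha>: "cmod \<alpha> = 1" "lft a b c d \<alpha> = \<alpha>" and \<kappa>: "1 \<le> \<kappa>"
    "of_real \<kappa> * (a * d - b * c) = (c * \<alpha> + d)\<^sup>2" for \<alpha> \<kappa>
  proof (rule half_plane_model_at[OF lf \<alpha>])
    fix \<kappa>' \<mu> assume \<mu>: "0 \<le> Re \<mu>" "c = 0 \<Longrightarrow> \<mu> = complex_of_real \<kappa>' - 1"
      and \<kappa>': "complex_of_real \<kappa>' * (a * d - b * c) = (c * \<alpha> + d)\<^sup>2"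
      and W: "\<And>z. c * z + d \<noteq> 0 \<Longrightarrow> \<alpha> \<noteq> z \<Longrightarrow>
       \<alpha> \<noteq> lft a b c d z \<and> cayley \<alpha> (lft a b c d z) = complex_of_real \<kappa>' * cayley \<alpha> z + \<mu>"
    have "\<kappa>' = \<kappa>" using \<kappa>' \<kappa>(2) lf_selfmapD(1)[OF lf] by (metis mult_right_cancel of_real_eq_iff)
    have WD: "cayley \<alpha> (lft a b c d z) = of_real \<kappa> * cayley \<alpha> z + \<mu>" if "z \<in> D" for z
      using W[of z] that lf not_mem_D[OF \<alpha>(1) that] \<open>\<kappa>' = \<kappa>\<close> by (auto simp: lf_selfmap_def)
    \<comment> \<open>Otherwise the map would be the identity in the half-plane coordinate and fix
      0.\<close>
    have "\<mu> \<noteq> 0" if "\<kappa> = 1"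
    proof
      assume "\<mu> = 0"
      have D0: "0 \<in> D" by (simp add: D_def)
      then have "lft a b c d 0 \<in> D" using lf by (auto simp: lf_selfmap_def)
      then have "lft a b c d 0 = 0"
        using WD[OF D0] \<open>\<mu> = 0\<close> that D0 cayley_inv_cayley[OF \<alpha>(1) not_mem_D[OF \<alpha>(1)]]
        by (metis add.right_neutral mult_1 of_real_1)
      then show False using no D0 by blast
    qed
    then show thesis
      by (rule result[OF \<alpha> \<kappa>(1) \<mu>(1) \<kappa>(2), rotated]) (use \<mu>(2) WD \<open>\<kappa>' = \<kappa>\<close> in auto)
  qed
  show thesis
  proof (rule half_plane_model_at[OF lf \<alpha>])
    fix \<kappa> \<mu> assume \<kappa>: "0 < \<kappa>" "complex_of_real \<kappa> * (a * d - b * c) = (c * \<alpha> + d)\<^sup>2" and \<mu>: "0 \<le> Re \<mu>"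
      and W: "\<And>z. c * z + d \<noteq> 0 \<Longrightarrow> \<alpha> \<noteq> z \<Longrightarrow>
       \<alpha> \<noteq> lft a b c d z \<and> cayley \<alpha> (lft a b c d z) = complex_of_real \<kappa> * cayley \<alpha> z + \<mu>"
    show thesis
    proof (cases "1 \<le> \<kappa>")
      case True
      with good[OF \<alpha>] \<kappa> show thesis by blast
    next
      case False
      \<comment> \<open>The fixed point of w -> \<kappa> w + \<mu>. As \<kappa> < 1, its real part
        is nonnegative, so it corresponds to a fixed point in the closed disc, necessarily on the
        circle.\<close>
      define \<beta> where "\<beta> = \<mu> / of_real (1 - \<kappa>)"
      define z where "z = cayley_inv \<alpha> \<beta>"
      have k1: "complex_of_real (1 - \<kappa>) \<noteq> 0" using False by simp
      have Re\<beta>: "0 \<le> Re \<beta>" unfolding \<beta>_def Re_divide_of_real using \<mu> False by simp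
      have fix\<beta>: "of_real \<kappa> * \<beta> + \<mu> = \<beta>" using k1 by (simp add: \<beta>_def field_simps)
      have b1: "\<beta> + 1 \<noteq> 0" using Re\<beta> by (auto simp: complex_eq_iff)
      have az: "\<alpha> - z = 2 * \<alpha> / (\<beta> + 1)" using b1 by (simp add: z_def cayley_inv_def field_simps)
      have "\<alpha> \<noteq> 0" using \<alpha> by auto
      then have "\<alpha> \<noteq> z" using az b1 by auto
      have cz: "cayley \<alpha> z = \<beta>" using cayley_plus_1[OF \<open>\<alpha> \<noteq> z\<close>] az b1 \<open>\<alpha> \<noteq> 0\<close> by simp
      have nz: "1 - (cmod z)\<^sup>2 = 4 * Re \<beta> / (cmod (\<beta> + 1))\<^sup>2"
        unfolding z_def by (rule one_minus_cayley_inv[OF \<alpha>(1) b1])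
      have z1: "cmod z \<le> 1"
      proof (rule power2_le_imp_le)
        have "0 \<le> 4 * Re \<beta> / (cmod (\<beta> + 1))\<^sup>2" using Re\<beta> by simp
        then show "(cmod z)\<^sup>2 \<le> 1\<^sup>2" using nz by simp
      qed simp
      have den: "c * z + d \<noteq> 0" using lf_selfmap_closed(2)[OF lf z1] .
      have fixz: "lft a b c d z = z"
        using W[OF den \<open>\<alpha> \<noteq> z\<close>] cz fix\<beta> cayley_inv_cayley[OF \<alpha>(1)] z_def by metis
      then have "z \<notin> D" using no by blast
      then have z1: "cmod z = 1" using z1 by (simp add: D_def)
      have "z - \<alpha> = (a * d - b * c) * (z - \<alpha>) / ((c * z + d) * (c * \<alpha> + d))"
        using lft_diff_fixed[OF \<alpha>(2) lf_selfmap_closed(2)[OF lf] den] \<alpha> fixz by simp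
      \<comment> \<open>This relation makes the slopes at the two fixed points inverse to each
        other.\<close>
      then have prod: "(c * z + d) * (c * \<alpha> + d) = a * d - b * c"
        using \<open>\<alpha> \<noteq> z\<close> den lf_selfmap_closed(2)[OF lf, of \<alpha>] \<alpha> by (simp add: eq_divide_eq)
      have "of_real \<kappa> * ((c * z + d)\<^sup>2 * (a * d - b * c)) = (c * z + d)\<^sup>2 * (of_real \<kappa> * (a * d - b * c))"
        by (simp add: ac_simps)
      also have "\<dots> = ((c * z + d) * (c * \<alpha> + d))\<^sup>2" by (simp only: \<kappa>(2) power_mult_distrib)
      also have "\<dots> = (a * d - b * c) * (a * d - b * c)" by (simp only: prod power2_eq_square)
      finally have "of_real \<kappa> * (c * z + d)\<^sup>2 = a * d - b * c"
        using lf_selfmapD(1)[OF lf] by (simp flip: mult.assoc)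
      then have "of_real (1 / \<kappa>) * (a * d - b * c) = (c * z + d)\<^sup>2"
        using \<kappa>(1) by (simp add: field_simps)
      moreover have "1 \<le> 1 / \<kappa>" using False \<kappa>(1) by simp
      ultimately show thesis using good[OF z1 fixz] by blast
    qed
  qed
qed

text \<open>In the half-plane the orbit runs to infinity, by translation if \<kappa> = 1 and
  geometrically if \<kappa> > 1; infinity corresponds to \<alpha>.\<close>

lemma funpow_lft_tendsto:
  assumes \<alpha>: "cmod \<alpha> = 1" and sub: "\<phi> ` D \<subseteq> D" and \<kappa>: "1 \<le> \<kappa>" "\<kappa> = 1 \<Longrightarrow> \<mu> \<noteq> 0" and \<mu>: "0 \<le> Re \<mu>"
    and W: "\<And>z. z \<in> D \<Longrightarrow> cayley \<alpha> (\<phi> z) = of_real \<kappa> * cayley \<alpha> z + \<mu>" and z: "z \<in> D"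
  shows "(\<lambda>n. (\<phi> ^^ n) z) \<longlonglongrightarrow> \<alpha>"
proof -
  define w where "w n = cayley \<alpha> ((\<phi> ^^ n) z)" for n
  have wS: "w (Suc n) = of_real \<kappa> * w n + \<mu>" for n
    using W[OF funpow_in_D[OF sub z]] by (simp add: w_def)
  have pos: "0 < Re (w n)" for n using Re_cayley_pos[OF \<alpha> funpow_in_D[OF sub z]] by (simp add: w_def)
  have "filterlim (\<lambda>n. w n + 1) at_infinity sequentially"
  proof (cases "\<kappa> = 1")
    case True
    have shift: "w n = w 0 + of_nat n * \<mu>" for n
      by (induction n) (simp_all add: wS True algebra_simps)
    have eq: "w n + 1 = (w 0 + 1) + \<mu> * of_nat n" for n
      by (subst shift) (simp only: ac_simps)
    have "filterlim (\<lambda>n. \<mu> * of_nat n) at_infinity sequentially"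
      using \<kappa> True by (intro tendsto_mult_filterlim_at_infinity[OF tendsto_const] tendsto_of_nat) auto
    then show ?thesis by (subst ext[OF eq]) (rule tendsto_add_filterlim_at_infinity[OF tendsto_const])
  next
    case False
    then have k1: "1 < \<kappa>" using \<kappa> by simp
    \<comment> \<open>Adding \<gamma> moves the fixed point -\<gamma> to 0. The start w 0 has
      positive real part, so it is not that fixed point.\<close>
    define \<gamma> where "\<gamma> = \<mu> / of_real (\<kappa> - 1)"
    have \<gamma>: "0 \<le> Re \<gamma>" unfolding \<gamma>_def Re_divide_of_real using \<mu> k1 by simp
    have "complex_of_real (\<kappa> - 1) \<noteq> 0" using k1 by simp
    then have "\<mu> = of_real (\<kappa> - 1) * \<gamma>" unfolding \<gamma>_def by simp
    then have \<mu>_eq: "\<mu> = of_real \<kappa> * \<gamma> - \<gamma>" by (simp add: algebra_simps)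
    have pow: "w n + \<gamma> = (w 0 + \<gamma>) * of_real \<kappa> ^ n" for n
    proof (induction n)
      case (Suc n)
      have "w (Suc n) + \<gamma> = of_real \<kappa> * (w n + \<gamma>)" by (simp add: wS \<mu>_eq algebra_simps)
      also have "\<dots> = of_real \<kappa> * ((w 0 + \<gamma>) * of_real \<kappa> ^ n)" by (simp only: Suc)
      finally show ?case by (simp only: power_Suc ac_simps)
    qed simp
    have eq: "w n + 1 = (1 - \<gamma>) + (w 0 + \<gamma>) * of_real \<kappa> ^ n" for n
      by (subst pow[symmetric]) simp
    have nz: "w 0 + \<gamma> \<noteq> 0" using pos[of 0] \<gamma> by (auto simp: complex_eq_iff)
    have "filterlim (\<lambda>n. complex_of_real \<kappa> ^ n) at_infinity sequentially"
      unfolding filterlim_at_infinity_conv_norm_at_top norm_power norm_of_real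
      using k1 filterlim_realpow_sequentially_gt1[of \<kappa>] by simp real_asymp
    then have "filterlim (\<lambda>n. (w 0 + \<gamma>) * of_real \<kappa> ^ n) at_infinity sequentially"
      by (rule tendsto_mult_filterlim_at_infinity[OF tendsto_const nz])
    then show ?thesis by (subst ext[OF eq]) (rule tendsto_add_filterlim_at_infinity[OF tendsto_const])
  qed
  then have "(\<lambda>n. 2 * \<alpha> / (w n + 1)) \<longlonglongrightarrow> 0" by (rule tendsto_divide_0[OF tendsto_const])
  then have "(\<lambda>n. \<alpha> - 2 * \<alpha> / (w n + 1)) \<longlonglongrightarrow> \<alpha> - 0" by (intro tendsto_diff tendsto_const)
  moreover have "(\<phi> ^^ n) z = \<alpha> - 2 * \<alpha> / (w n + 1)" for n
  proof -
    have "(\<phi> ^^ n) z = cayley_inv \<alpha> (w n)"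
      unfolding w_def using cayley_inv_cayley[OF \<alpha> not_mem_D[OF \<alpha> funpow_in_D[OF sub z]]] by simp
    then show ?thesis using Re_plus_1_neq_0[OF pos[of n]] by (simp add: cayley_inv_def field_simps)
  qed
  ultimately show ?thesis by simp
qed

theorem theorem6p12:
  fixes a b c d :: complex
  assumes "lf_selfmap a b c d"
  shows "h2_recurrent (comp_op (lft a b c d)) \<longleftrightarrow>
           (lf_hyperbolic a b c d \<and> (\<forall>z\<in>D. \<not> lf_fixed a b c d (Some z)))
         \<or> (lf_parabolic a b c d \<and> lf_automorphism a b c d)
         \<or> lf_elliptic_aut a b c d"
proof -
  note S = lf_selfmapD[OF assms]
  let ?\<phi> = "lft a b c d"
  have fixed_D: "lf_fixed a b c d (Some z) \<longleftrightarrow> ?\<phi> z = z" if "z \<in> D" for z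
    using assms that by (auto simp: lf_fixed_def lf_selfmap_def)
  show ?thesis
  proof (cases "\<exists>p\<in>D. ?\<phi> p = p")
    case True
    then obtain p where p: "p \<in> D" "?\<phi> p = p" by blast
    have "h2_recurrent (comp_op ?\<phi>) \<longleftrightarrow> ?\<phi> ` D = D"
      by (rule recurrent_iff_automorphism_fixed_point[OF S(3,4,2) p])
    \<comment> \<open>A fixed point in the disc contradicts the first two alternatives, and the
      third now says that the map is onto.\<close>
    then show ?thesis
      using p fixed_D assms unfolding lf_elliptic_aut_def lf_automorphism_def lf_parabolic_def by blast
  next
    case False
    then have no: "\<And>z. z \<in> D \<Longrightarrow> ?\<phi> z \<noteq> z" by blast
    obtain \<alpha> \<kappa> \<mu> where \<alpha>: "cmod \<alpha> = 1" "?\<phi> \<alpha> = \<alpha>" and \<kappa>: "1 \<le> \<kappa>" and \<mu>: "0 \<le> Re \<mu>"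
      and mult: "of_real \<kappa> * (a * d - b * c) = (c * \<alpha> + d)\<^sup>2"
      and c0: "c = 0 \<Longrightarrow> \<mu> = of_real \<kappa> - 1" and \<kappa>1: "\<kappa> = 1 \<Longrightarrow> \<mu> \<noteq> 0"
      and W: "\<And>z. z \<in> D \<Longrightarrow> cayley \<alpha> (?\<phi> z) = of_real \<kappa> * cayley \<alpha> z + \<mu>"
      using half_plane_model[OF assms no] by blast
    have den: "c * \<alpha> + d \<noteq> 0" using lf_selfmap_closed(2)[OF assms] \<alpha> by simp
    have attr: "lf_attractive a b c d \<alpha>"
      unfolding lf_attractive_def lf_fixed_def
      using \<alpha> den funpow_lft_tendsto[OF \<alpha>(1) S(2) \<kappa> \<kappa>1 \<mu> W] by simp
    have not_ell: "\<not> lf_elliptic_aut a b c d" using no fixed_D by (auto simp: lf_elliptic_aut_def)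
    show ?thesis
    proof (cases "\<kappa> = 1")
      case False
      then have k1: "1 < \<kappa>" using \<kappa> by simp
      define \<gamma> where "\<gamma> = \<mu> / of_real (\<kappa> - 1)"
      have \<gamma>: "0 \<le> Re \<gamma>" unfolding \<gamma>_def Re_divide_of_real using \<mu> k1 by simp
      have kc: "complex_of_real (\<kappa> - 1) \<noteq> 0" using k1 by simp
      then have "\<mu> = of_real (\<kappa> - 1) * \<gamma>" unfolding \<gamma>_def by simp
      then have conj: "cayley \<alpha> (?\<phi> z) + \<gamma> = of_real \<kappa> * (cayley \<alpha> z + \<gamma>)" if "z \<in> D" for z
        using W[OF that] by (simp add: algebra_simps)
      have rec: "h2_recurrent (comp_op ?\<phi>)"
        by (rule recurrent_hyperbolic[OF \<alpha>(1) \<gamma> k1 S(2) conj])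
      have "\<exists>\<beta>. lf_fixed a b c d \<beta> \<and> \<beta> \<noteq> Some \<alpha>"
      proof (cases "c = 0")
        case True
        then show ?thesis by (intro exI[of _ None]) (simp add: lf_fixed_def)
      next
        case False
        \<comment> \<open>The solution of (c z + d)(c \<alpha> + d) = a d - b c, the criterion for a
          second fixed point, with (c \<alpha> + d)^2 replaced by \<kappa> (a d - b c).\<close>
        define z where "z = \<alpha> - (a * d - b * c) * of_real (\<kappa> - 1) / (c * (c * \<alpha> + d))"
        have "z \<noteq> \<alpha>" using S(1) kc False den by (simp add: z_def)
        have "c * z + d = (c * \<alpha> + d) - (a * d - b * c) * of_real (\<kappa> - 1) / (c * \<alpha> + d)"
          unfolding z_def right_diff_distrib times_divide_eq_right
          using mult_divide_mult_cancel_left[OF False] by simp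
        then have "(c * z + d) * (c * \<alpha> + d) =
            ((c * \<alpha> + d) - (a * d - b * c) * of_real (\<kappa> - 1) / (c * \<alpha> + d)) * (c * \<alpha> + d)"
          by (rule arg_cong)
        also have "\<dots> = (c * \<alpha> + d)\<^sup>2 - (a * d - b * c) * of_real (\<kappa> - 1)"
          unfolding left_diff_distrib[of "c * \<alpha> + d" "(a * d - b * c) * of_real (\<kappa> - 1) / (c * \<alpha> + d)"]
            power2_eq_square using den by simp
        also have "\<dots> = a * d - b * c" unfolding mult[symmetric] by (simp add: algebra_simps)
        finally have prod: "(c * z + d) * (c * \<alpha> + d) = a * d - b * c" .
        then have dz: "c * z + d \<noteq> 0" using S(1) by auto
        have "?\<phi> z = z" using lft_diff_fixed[OF \<alpha>(2) den dz] S(1) unfolding prod by simp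
        then show ?thesis using dz \<open>z \<noteq> \<alpha>\<close> by (intro exI[of _ "Some z"]) (simp add: lf_fixed_def)
      qed
      then have "lf_hyperbolic a b c d"
        unfolding lf_hyperbolic_def using \<alpha> attr no fixed_D by blast
      then show ?thesis using rec no fixed_D by blast
    next
      case True
      \<comment> \<open>For c = 0 the translation would be \<mu> = \<kappa> - 1 = 0.\<close>
      have cnz: "c \<noteq> 0" using c0 \<kappa>1 True by auto
      have unique: "lf_fixed a b c d p \<longleftrightarrow> p = Some \<alpha>" for p
      proof
        assume p: "lf_fixed a b c d p"
        then obtain z where z: "p = Some z" "c * z + d \<noteq> 0" "?\<phi> z = z"
          using cnz by (auto simp: lf_fixed_def split: option.splits)
        have "z = \<alpha>"
        proof (rule ccontr)
          assume "z \<noteq> \<alpha>"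
          then have "(c * z + d) * (c * \<alpha> + d) = a * d - b * c"
            using lft_diff_fixed[OF \<alpha>(2) den z(2)] z den by (simp add: eq_divide_eq)
          \<comment> \<open>For \<kappa> = 1 the determinant is (c \<alpha> + d)^2, so the criterion
            forces c z + d = c \<alpha> + d.\<close>
          also have "\<dots> = (c * \<alpha> + d) * (c * \<alpha> + d)" using mult True by (simp add: power2_eq_square)
          finally show False using den cnz \<open>z \<noteq> \<alpha>\<close> by simp
        qed
        then show "p = Some \<alpha>" using z by simp
      qed (use attr in \<open>simp add: lf_attractive_def\<close>)
      have par: "lf_parabolic a b c d"
        unfolding lf_parabolic_def using \<alpha> attr unique no fixed_D by blast
      have D0: "0 \<in> D" by (simp add: D_def)
      have not_hyp: "\<not> lf_hyperbolic a b c d"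
      proof
        assume "lf_hyperbolic a b c d"
        then obtain \<alpha>' \<beta> where "lf_attractive a b c d \<alpha>'" "lf_fixed a b c d \<beta>" "\<beta> \<noteq> Some \<alpha>'"
          unfolding lf_hyperbolic_def by blast
        then show False using unique unfolding lf_attractive_def by metis
      qed
      have W1: "cayley \<alpha> (?\<phi> z) = cayley \<alpha> z + \<mu>" if "z \<in> D" for z using W[OF that] True by simp
      show ?thesis
      proof (cases "Re \<mu> = 0")
        case True
        then have \<mu>_eq: "\<mu> = \<i> * of_real (Im \<mu>)" by (simp add: complex_eq_iff)
        have "Im \<mu> \<noteq> 0" using \<kappa>1 \<open>\<kappa> = 1\<close> True by (auto simp: complex_eq_iff)
        then have rec: "h2_recurrent (comp_op ?\<phi>)"
          using W1 \<mu>_eq by (intro recurrent_parabolic_automorphism[OF \<alpha>(1) _ S(2), of "Im \<mu>"]) auto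
        have "y \<in> ?\<phi> ` D" if y: "y \<in> D" for y
        proof
          \<comment> \<open>An imaginary translation can be undone inside the half-plane.\<close>
          define u where "u = cayley_inv \<alpha> (cayley \<alpha> y - \<mu>)"
          have pos: "0 < Re (cayley \<alpha> y - \<mu>)" using Re_cayley_pos[OF \<alpha>(1) y] True by simp
          show u: "u \<in> D" unfolding u_def by (rule cayley_inv_in_D[OF \<alpha>(1) pos])
          have "cayley \<alpha> (?\<phi> u) = cayley \<alpha> y"
            using W1[OF u] cayley_cayley_inv[OF \<alpha>(1) pos] by (simp add: u_def)
          moreover have "?\<phi> u \<in> D" using S(2) u by blast
          ultimately show "y = ?\<phi> u"
            using cayley_inv_cayley[OF \<alpha>(1) not_mem_D[OF \<alpha>(1)]] y by metis
        qed
        then have "lf_automorphism a b c d" unfolding lf_automorphism_def using assms S(2) by blast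
        then show ?thesis using rec par by blast
      next
        case False
        then have pos: "0 < Re \<mu>" using \<mu> by simp
        have "\<not> lf_automorphism a b c d"
        proof
          assume "lf_automorphism a b c d"
          then have onto: "?\<phi> ` D = D" by (simp add: lf_automorphism_def)
          \<comment> \<open>The point \<mu>/2 lies in the half-plane but not in the image, where
            real parts exceed Re \<mu>.\<close>
          have half: "0 < Re (\<mu> / 2)" using pos by simp
          have "cayley_inv \<alpha> (\<mu> / 2) \<in> ?\<phi> ` D" using cayley_inv_in_D[OF \<alpha>(1) half] onto by simp
          then obtain u where u: "u \<in> D" "?\<phi> u = cayley_inv \<alpha> (\<mu> / 2)" by force
          have "\<mu> / 2 = cayley \<alpha> u + \<mu>" using W1[OF u(1)] u(2) cayley_cayley_inv[OF \<alpha>(1) half] by simp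
          then have "Re (\<mu> / 2) = Re (cayley \<alpha> u) + Re \<mu>" by (metis plus_complex.sel(1))
          then show False using Re_cayley_pos[OF \<alpha>(1) u(1)] pos by simp
        qed
        then show ?thesis
          using not_recurrent_parabolic[OF \<alpha>(1) pos S(2) W1] not_hyp not_ell by blast
      qed
    qed
  qed
qed

end
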